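(* Let $m\in\{1,2,3\}$. Let $\mu$ be a nontrivial probability measure on the unit circle $\partial\mathbb D$, with Lebesgue decomposition $d\mu(\theta)=w(\theta)\frac{d\theta}{2\pi}+d\mu_s(\theta)$, and let $\alpha=\{\alpha_n\}_{n\ge 0}$ be its sequence of Verblunsky coefficients. If $$\int_0^{2\pi}(1-\cos\theta)^m\log w(\theta)\,\frac{d\theta}{2\pi}>-\infty,$$ then $$(S-1)^m\alpha\in\ell^2\quad\text{and}\quad \alpha\in\ell^{2m+2},$$ where $S$ is the shift operator $(S\alpha)_n=\alpha_{n+1}$.
   Context: $\mathbb D=\{z\in\mathbb C:|z|<1\}$, and $\partial\mathbb D$ is the unit circle, parametrized by $e^{i\theta}$, $\theta\in[0,2\pi)$. A probability measure on $\partial\mathbb D$ is nontrivial if its support is an infinite set. In the Lebesgue decomposition, $w$ is the density of the absolutely continuous part of $\mu$ with respect to $\frac{d\theta}{2\pi}$ and $\mu_s$ is the singular part. Verblunsky coefficients: let $\{\Phi_n\}_{n\ge0}$ be the monic orthogonal polynomials of $\mu$ ($\Phi_n$ is monic of degree $n$ and the $\Phi_n$ are pairwise orthogonal in $L^2(\partial\mathbb D,d\mu)$), and set $\Phi_n^*(z)=z^n\overline{\Phi_n(1/\bar z)}$. The Verblunsky coefficients $\alpha_n\in\mathbb D$ are the unique numbers for which the Szegő recurrence $$\Phi_{n+1}(z)=z\Phi_n(z)-\overline{\alpha_n}\,\Phi_n^*(z),\quad \Phi_0\equiv1,$$ holds for all $n\ge0$. In particular $|\alpha_n|<1$ for all $n$.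 The operator $S$ acts on sequences by $(S\alpha)_n=\alpha_{n+1}$, the symbol $1$ denotes the identity operator, and $(S-1)^m$ is the $m$-th power, i.e. the $m$-th forward difference. For $p\ge 1$, a sequence $\beta=\{\beta_n\}_{n\ge0}$ is in $\ell^p$ if $\sum_{n=0}^\infty|\beta_n|^p<\infty$. Since $w\in L^1$, the positive part of $(1-\cos\theta)^m\log w(\theta)$ is integrable, so the integral in the hypothesis is well defined in $[-\infty,\infty)$ (with $\log 0=-\infty$). *)

theory Defs
  imports "HOL-Analysis.Analysis" "HOL-Probability.Probability"
    "HOL-Computational_Algebra.Polynomial"
begin

section \<open>Measures on the unit circle\<close>

definition circle_borel :: "complex measure" where
  "circle_borel = restrict_space borel (sphere 0 1)"

definition measure_support :: "complex measure \<Rightarrow> complex set" where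
  "measure_support \<mu> =
     {z \<in> space \<mu>. \<forall>U. open U \<and> z \<in> U \<longrightarrow> emeasure \<mu> (U \<inter> space \<mu>) > 0}"

definition nontrivial_prob_on_circle :: "complex measure \<Rightarrow> bool" where
  "nontrivial_prob_on_circle \<mu> \<longleftrightarrow>
     sets \<mu> = sets circle_borel \<and> prob_space \<mu> \<and> infinite (measure_support \<mu>)"

text \<open>The measure \<open>d\<theta> / 2\<pi>\<close> on \<open>[0, 2\<pi>)\<close>. It lives on the whole real line and
  gives no mass to the complement of \<open>[0, 2\<pi>)\<close>.\<close>

definition angle_measure :: "real measure" where
  "angle_measure = uniform_measure lborel {0..<2 * pi}"

definition on_circle :: "real measure \<Rightarrow> complex measure" where
  "on_circle M = distr M circle_borel cis"

definition mutually_singular :: "'a measure \<Rightarrow> 'a measure \<Rightarrow> bool" where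
  "mutually_singular M N \<longleftrightarrow>
     (\<exists>A \<in> sets M \<inter> sets N. emeasure M A = 0 \<and> emeasure N (space N - A) = 0)"

text \<open>\<open>d\<mu> = w d\<theta>/2\<pi> + d\<mu>\<^sub>s\<close>, the density \<open>w\<close> being a function of the angle of which
  only the values on \<open>[0, 2\<pi>)\<close> matter.\<close>

definition lebesgue_decomposition ::
    "complex measure \<Rightarrow> (real \<Rightarrow> real) \<Rightarrow> complex measure \<Rightarrow> bool" where
  "lebesgue_decomposition \<mu> w \<mu>s \<longleftrightarrow>
     w \<in> borel_measurable borel \<and> (\<forall>\<theta>\<in>{0..<2 * pi}. 0 \<le> w \<theta>) \<and>
     sets \<mu>s = sets circle_borel \<and>
     mutually_singular (on_circle angle_measure) \<mu>s \<and>
     (\<forall>A \<in> sets circle_borel.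
        emeasure \<mu> A =
          emeasure (on_circle (density angle_measure (\<lambda>\<theta>. ennreal (w \<theta>)))) A + emeasure \<mu>s A)"

section \<open>Verblunsky coefficients\<close>

definition monic_orthogonal_polys :: "complex measure \<Rightarrow> (nat \<Rightarrow> complex poly) \<Rightarrow> bool" where
  "monic_orthogonal_polys \<mu> \<Phi> \<longleftrightarrow>
     (\<forall>n. degree (\<Phi> n) = n \<and> lead_coeff (\<Phi> n) = 1) \<and>
     (\<forall>m n. m \<noteq> n \<longrightarrow> (LINT z|\<mu>. poly (\<Phi> m) z * cnj (poly (\<Phi> n) z)) = 0)"

text \<open>\<open>z^n\<close> times the conjugate of \<open>p (1 / cnj z)\<close>, for \<open>p\<close> of degree at most \<open>n\<close>, is a polynomial
  in \<open>z\<close>, but the formula itself gives the right value only for \<open>z \<noteq> 0\<close>, as \<open>1 / 0 = 0\<close>.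
  The recurrence below is therefore imposed for \<open>z \<noteq> 0\<close>, which determines it as an
  identity of polynomials.\<close>

definition reversed :: "nat \<Rightarrow> complex poly \<Rightarrow> complex \<Rightarrow> complex" where
  "reversed n p z = z ^ n * cnj (poly p (1 / cnj z))"

definition verblunsky_coeffs :: "complex measure \<Rightarrow> (nat \<Rightarrow> complex) \<Rightarrow> bool" where
  "verblunsky_coeffs \<mu> \<alpha> \<longleftrightarrow>
     (\<exists>\<Phi>. monic_orthogonal_polys \<mu> \<Phi> \<and>
       (\<forall>n z. z \<noteq> 0 \<longrightarrow>
          poly (\<Phi> (Suc n)) z = z * poly (\<Phi> n) z - cnj (\<alpha> n) * reversed n (\<Phi> n) z))"

section \<open>Logarithmic integrals\<close>

definition ext_ln :: "real \<Rightarrow> ereal" where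
  "ext_ln x = (if x > 0 then ereal (ln x) else - \<infinity>)"

text \<open>The integral of the positive part minus that of the negative part; \<^const>\<open>e2ennreal\<close>
  sends negative values to \<open>0\<close>. It is meaningful if one of the two is finite
  (note that \<open>\<infinity> - \<infinity> = \<infinity>\<close> in \<^typ>\<open>ereal\<close>). In the integrals of \<open>(1 - cos \<theta>)^m log w(\<theta>)\<close> with
  \<open>w\<close> integrable, the positive part always has a finite integral.\<close>

definition ext_integral :: "'a measure \<Rightarrow> ('a \<Rightarrow> ereal) \<Rightarrow> ereal" where
  "ext_integral M f =
     enn2ereal (\<integral>\<^sup>+ x. e2ennreal (f x) \<partial>M) - enn2ereal (\<integral>\<^sup>+ x. e2ennreal (- f x) \<partial>M)"

section \<open>Sequences\<close>

definition shift :: "(nat \<Rightarrow> complex) \<Rightarrow> nat \<Rightarrow> complex" where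
  "shift \<beta> n = \<beta> (Suc n)"

definition shift_minus_one :: "(nat \<Rightarrow> complex) \<Rightarrow> nat \<Rightarrow> complex" where
  "shift_minus_one \<beta> n = shift \<beta> n - \<beta> n"

definition ell :: "nat \<Rightarrow> (nat \<Rightarrow> complex) set" where
  "ell p = {\<beta>. summable (\<lambda>n. norm (\<beta> n) ^ p)}"

end

theory Submission
  imports Defs "HOL-Complex_Analysis.Complex_Analysis"
begin

text \<open>
  Put \<open>q = (1 - cos \<theta>)\<^sup>m\<close> and \<open>N\<^sub>n = \<parallel>\<Phi>\<^sub>n\<parallel>\<^sup>2 = \<Prod>\<^sub>j\<^sub><\<^sub>n (1 - |\<alpha>\<^sub>j|\<^sup>2)\<close>. Integrating
  \<open>log (w |\<Phi>\<^sub>n|\<^sup>2 / N\<^sub>n) \<le> w |\<Phi>\<^sub>n|\<^sup>2 / N\<^sub>n\<close> against \<open>q\<close> and using \<open>\<integral> |\<Phi>\<^sub>n|\<^sup>2 w \<le> N\<^sub>n\<close> bounds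
  \<open>\<integral> q log (|\<Phi>\<^sub>n|\<^sup>2 / N\<^sub>n)\<close> from above, uniformly in \<open>n\<close>. On the circle \<open>|\<Phi>\<^sub>n| = |\<Phi>\<^sub>n\<^sup>*|\<close>, and
  \<open>\<Phi>\<^sub>n\<^sup>*\<close> has no zeros in the closed disk, so the integral is a combination of \<open>log N\<^sub>n\<close> and of the
  first \<open>m\<close> Taylor coefficients of \<open>log \<Phi>\<^sub>n\<^sup>*\<close>. By the recurrence it is therefore a sum over \<open>j < n\<close>
  of an explicit function of \<open>\<alpha>\<^sub>j, \<dots>, \<alpha>\<^sub>j\<^sub>-\<^sub>3\<close>. Up to telescoping, which is harmless because
  \<open>|\<alpha>\<^sub>j| < 1\<close>, this function dominates a multiple of
  \<open>|((S - 1)\<^sup>m \<alpha>)\<^sub>j\<^sub>-\<^sub>m|\<^sup>2 + |\<alpha>\<^sub>j|\<^sup>2\<^sup>m\<^sup>+\<^sup>2\<close>: its polynomial part up to degree \<open>2m\<close> is a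
  sum of squares, and the remaining terms of \<open>- log (1 - |\<alpha>\<^sub>j|\<^sup>2)\<close> are nonnegative.
\<close>

section \<open>Positivity of the local terms\<close>

text \<open>The increments, from \<open>n\<close> to \<open>n + 1\<close>, of the Taylor coefficients of orders 1, 2, 3 at the
  origin of \<open>log \<Phi>\<^sub>n\<^sup>*\<close>, where \<open>(x, y, z, t)\<close> stands for
  \<open>(\<alpha>\<^sub>n\<^sub>-\<^sub>3, \<alpha>\<^sub>n\<^sub>-\<^sub>2, \<alpha>\<^sub>n\<^sub>-\<^sub>1, \<alpha>\<^sub>n)\<close>.\<close>

definition log_coeff_step1 :: "complex \<Rightarrow> complex \<Rightarrow> complex" where
  "log_coeff_step1 z t = t * cnj z"

definition log_coeff_step2 :: "complex \<Rightarrow> complex \<Rightarrow> complex \<Rightarrow> complex" where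
  "log_coeff_step2 y z t = t * cnj y * (1 - z * cnj z) - t\<^sup>2 * (cnj z)\<^sup>2 / 2"

definition log_coeff_step3 :: "complex \<Rightarrow> complex \<Rightarrow> complex \<Rightarrow> complex \<Rightarrow> complex" where
  "log_coeff_step3 x y z t =
     t * (1 - z * cnj z) * (cnj x * (1 - y * cnj y) - z * (cnj y)\<^sup>2)
     - t\<^sup>2 * cnj z * cnj y * (1 - z * cnj z) + t ^ 3 * (cnj z) ^ 3 / 3"

text \<open>The difference of the two sides has derivative \<open>u ^ 4 / (1 - u)\<close>, a
  geometric tail. At x = |t|^2 the terms of order up to m enter the identities below exactly, and
  the term of order m + 1 supplies |t|^(2m+2).\<close>

lemma neg_ln_one_minus_ge:
  fixes x :: real
  assumes "0 \<le> x" "x < 1"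
  shows "x + x\<^sup>2 / 2 + x ^ 3 / 3 + x ^ 4 / 4 \<le> - ln (1 - x)"
proof -
  define f where "f = (\<lambda>x::real. - ln (1 - x) - (x + x\<^sup>2 / 2 + x ^ 3 / 3 + x ^ 4 / 4))"
  have "f 0 \<le> f x"
  proof (rule DERIV_nonneg_imp_nondecreasing[OF assms(1)])
    fix u :: real assume u: "0 \<le> u" "u \<le> x"
    then have lt: "u < 1" using assms by simp
    have "(f has_real_derivative (1 / (1 - u) - (1 + u + u\<^sup>2 + u ^ 3))) (at u)"
      unfolding f_def using lt
      by (auto intro!: derivative_eq_intros simp: field_simps power2_eq_square power3_eq_cube)
    moreover have "1 / (1 - u) - (1 + u + u\<^sup>2 + u ^ 3) = u ^ 4 / (1 - u)"
      using lt by (simp add: field_simps power2_eq_square power3_eq_cube power4_eq_xxxx)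
    moreover have "0 \<le> u ^ 4 / (1 - u)" using lt by simp
    ultimately show "\<exists>y. (f has_real_derivative y) (at u) \<and> 0 \<le> y" by metis
  qed
  then show ?thesis by (simp add: f_def)
qed

text \<open>Up to the factor 96, the telescoping part of the sum-of-squares decomposition below. Both were
  found by solving a semidefinite program numerically and rounding.\<close>

definition sum_rule_flux3 :: "complex \<Rightarrow> complex \<Rightarrow> complex \<Rightarrow> real" where
  "sum_rule_flux3 x y z =
      12 * (cmod x)\<^sup>2 + 120 * (cmod y)\<^sup>2 + 228 * (cmod z)\<^sup>2
      - 72 * Re (x * cnj y) - 288 * Re (y * cnj z) + 72 * Re (x * cnj z)
      + 60 * (cmod y) ^ 4 + 120 * (cmod z) ^ 4 - 12 * (cmod x)\<^sup>2 * (cmod y)\<^sup>2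
      + 12 * (cmod y)\<^sup>2 * (cmod z)\<^sup>2 - 12 * (cmod y)\<^sup>2 * Re (y * cnj z)
      + 6 * Re (x\<^sup>2 * (cnj y)\<^sup>2) - 78 * Re (y\<^sup>2 * (cnj z)\<^sup>2)
      + 12 * (cmod y)\<^sup>2 * Re (x * cnj y) - 72 * (cmod y)\<^sup>2 * Re (x * cnj z)
      + 24 * Re (x * y * (cnj z)\<^sup>2)
      + 40 * ((cmod x) ^ 6 + (cmod y) ^ 6 + (cmod z) ^ 6)
      - 8 * Re (y ^ 3 * (cnj z) ^ 3) - 80 * (cmod x) ^ 4 * (cmod y)\<^sup>2
      - 64 * (cmod y) ^ 4 * (cmod z)\<^sup>2 + 64 * (cmod x)\<^sup>2 * (cmod y) ^ 4
      + 80 * (cmod y)\<^sup>2 * (cmod z) ^ 4 - 24 * (cmod y)\<^sup>2 * Re (x * y * (cnj z)\<^sup>2)"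

text \<open>The left side is 96 times the one-step increment for the weight (1 - cos)^3, with - ln
  (1 - |t|^2) cut after |t|^6. \<open>A\<close> and \<open>B\<close> are cubic corrections to the
  third difference; their separate squares make it possible to remove them again.\<close>

lemma sum_rule_identity3:
  fixes x y z t :: complex
  defines "A \<equiv> x * (y * cnj y) - t * (z * cnj z)"
    and "B \<equiv> y\<^sup>2 * cnj z - z\<^sup>2 * cnj y"
  shows "240 * (cmod t)\<^sup>2 + 120 * (cmod t) ^ 4 + 80 * (cmod t) ^ 6
      - 360 * Re (log_coeff_step1 z t) + 144 * Re (log_coeff_step2 y z t)
      - 24 * Re (log_coeff_step3 x y z t) =
     sum_rule_flux3 y z t - sum_rule_flux3 x y z
     + 3 * (cmod (2 * (t - 3 * z + 3 * y - x) + 2 * A + B))\<^sup>2 + 6 * (cmod A)\<^sup>2 + 7 * (cmod B)\<^sup>2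
     + 6 * (cmod (y\<^sup>2 * cnj z + z\<^sup>2 * cnj y - x * (y * cnj y) - t * (z * cnj z)))\<^sup>2
     + 40 * (cmod (x * (x * cnj x - y * cnj y)))\<^sup>2 + 40 * (cmod (t * (t * cnj t - z * cnj z)))\<^sup>2
     + 6 * (cmod (y\<^sup>2 - x * y - z\<^sup>2 + y * z))\<^sup>2 + 6 * (cmod (z\<^sup>2 - z * t - y\<^sup>2 + y * z))\<^sup>2
     + 12 * (Re (cnj y * (2 * y - x - z)))\<^sup>2 + 12 * (Re (cnj z * (2 * z - y - t)))\<^sup>2"
    (is "?l = ?r")
proof -
  \<comment> \<open>Moduli and real parts are rewritten so that both sides become polynomials in the
    variables and their conjugates.\<close>
  have c: "complex_of_real (cmod u) ^ 2 = u * cnj u" for u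
    by (metis complex_norm_square of_real_power)
  have c4: "complex_of_real (cmod u) ^ 4 = (u * cnj u)\<^sup>2" for u
    unfolding c[symmetric] by (simp flip: power_mult)
  have c6: "complex_of_real (cmod u) ^ 6 = (u * cnj u) ^ 3" for u
    unfolding c[symmetric] by (simp flip: power_mult)
  note cnjs = complex_cnj_add complex_cnj_diff complex_cnj_mult complex_cnj_power
      complex_cnj_numeral complex_cnj_one complex_cnj_cnj
  \<comment> \<open>The constants 1/2 and 1/3 become atoms, known to \<open>algebra\<close> only
    through 2 h = 1 and 3 k = 1.\<close>
  define h where "h = (1/2 :: complex)"
  have v': "of_real (Re u) = h * (u + cnj u)" for u
    unfolding h_def by (simp add: complex_eq_iff)
  define k where "k = (1/3 :: complex)"
  have steps: "log_coeff_step1 z t = t * cnj z"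
    "log_coeff_step2 y z t = t * cnj y * (1 - z * cnj z) - t\<^sup>2 * (cnj z)\<^sup>2 * h"
    "log_coeff_step3 x y z t =
       t * (1 - z * cnj z) * (cnj x * (1 - y * cnj y) - z * (cnj y)\<^sup>2)
       - t\<^sup>2 * cnj z * cnj y * (1 - z * cnj z) + t ^ 3 * (cnj z) ^ 3 * k"
    by (simp_all add: log_coeff_step1_def log_coeff_step2_def log_coeff_step3_def h_def k_def)
  have hk: "2 * h = 1" "3 * k = 1" "cnj h = h" "cnj k = k" by (simp_all add: h_def k_def)
  have "complex_of_real ?l = complex_of_real ?r"
    unfolding sum_rule_flux3_def A_def B_def
      of_real_add of_real_diff of_real_mult of_real_power of_real_numeral of_real_1
      v' c c4 c6 steps cnjs hk(3,4)
    using hk(1,2) by algebra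
  then show ?thesis by (simp only: of_real_eq_iff)
qed

section \<open>Local bounds for the three weights\<close>

lemma cmod_sum3_squared_le: "(cmod (a + b + c))\<^sup>2 \<le> 3 * ((cmod a)\<^sup>2 + (cmod b)\<^sup>2 + (cmod c)\<^sup>2)"
proof -
  have "(cmod (a + b + c))\<^sup>2 \<le> (cmod a + cmod b + cmod c)\<^sup>2"
    by (intro power_mono) (metis add_right_mono norm_triangle_ineq order_trans, simp)
  also have "\<dots> \<le> 3 * ((cmod a)\<^sup>2 + (cmod b)\<^sup>2 + (cmod c)\<^sup>2)"
    using sum_squares_ge_zero[of "cmod a - cmod b" "cmod b - cmod c"]
      zero_le_power2[of "cmod a - cmod c"]
    by (simp add: power2_eq_square algebra_simps)
  finally show ?thesis .
qed

text \<open>The right side is the one-step increment of the sum rule for the weight c0 + c1 cos + c2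
  cos 2 + c3 cos 3. \<open>F\<close> telescopes along the sequence, and its continuity bounds it on
  the closed unit polydisk; \<open>D\<close> is the quantity to be summed.\<close>

definition sum_rule_local_bound ::
    "real \<Rightarrow> real \<Rightarrow> real \<Rightarrow> real \<Rightarrow> (complex \<Rightarrow> complex \<Rightarrow> complex \<Rightarrow> complex \<Rightarrow> real) \<Rightarrow> bool" where
  "sum_rule_local_bound c0 c1 c2 c3 D \<longleftrightarrow>
    (\<exists>F. continuous_on UNIV (\<lambda>(x, y, z). F x y z) \<and>
      (\<forall>x y z t. cmod t < 1 \<longrightarrow>
        D x y z t + F y z t - F x y z \<le>
          c1 * Re (log_coeff_step1 z t)
          + c2 * Re (log_coeff_step2 y z t) + c3 * Re (log_coeff_step3 x y z t)
          - c0 * ln (1 - (cmod t)\<^sup>2)))"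

text \<open>|t|^2 - Re (t cnj z) is half of |t - z|^2 plus the telescoping (|t|^2 - |z|^2) / 2; the
  next term of the logarithm gives |t|^4 / 2.\<close>

lemma sum_rule_local_bound1:
  "sum_rule_local_bound 1 (- 1) 0 0 (\<lambda>x y z t. ((cmod (t - z))\<^sup>2 + (cmod t) ^ 4) / 2)"
  unfolding sum_rule_local_bound_def
proof (intro exI[of _ "\<lambda>x y z. (cmod z)\<^sup>2 / 2"] conjI allI impI)
  fix x y z t :: complex assume "cmod t < 1"
  then have "(cmod t)\<^sup>2 < 1" by (simp add: abs_square_less_1)
  from neg_ln_one_minus_ge[OF _ this]
  have "(cmod t)\<^sup>2 + (cmod t) ^ 4 / 2 \<le> - ln (1 - (cmod t)\<^sup>2)"
    by (simp flip: power_mult) (smt (verit) zero_le_power norm_ge_zero divide_nonneg_pos)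
  moreover have "(cmod (t - z))\<^sup>2 = (cmod t)\<^sup>2 + (cmod z)\<^sup>2 - 2 * Re (t * cnj z)"
    unfolding cmod_power2 by (simp add: power2_eq_square algebra_simps)
  ultimately show "((cmod (t - z))\<^sup>2 + (cmod t) ^ 4) / 2 + (cmod t)\<^sup>2 / 2 - (cmod z)\<^sup>2 / 2
      \<le> - 1 * Re (log_coeff_step1 z t)
          + 0 * Re (log_coeff_step2 y z t) + 0 * Re (log_coeff_step3 x y z t)
          - 1 * ln (1 - (cmod t)\<^sup>2)"
    unfolding log_coeff_step1_def by (simp add: field_simps)
qed (auto intro!: continuous_intros simp: case_prod_unfold)

lemma sum_rule_local_bound2:
  "sum_rule_local_bound (3 / 2) (- 2) (1 / 2) 0
     (\<lambda>x y z t. ((cmod (t - 2 * z + y))\<^sup>2 + (cmod t) ^ 6) / 4)"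
  unfolding sum_rule_local_bound_def
proof (intro exI[of _ "\<lambda>x y z. 5 / 4 * (cmod z)\<^sup>2 + (cmod y)\<^sup>2 / 4 - Re (z * cnj y)
      + 3 / 8 * (cmod z) ^ 4 + (cmod y)\<^sup>2 * (cmod z)\<^sup>2 / 4"] conjI allI impI)
  fix x y z t :: complex assume "cmod t < 1"
  then have "(cmod t)\<^sup>2 < 1" by (simp add: abs_square_less_1)
  from neg_ln_one_minus_ge[OF _ this]
  have ln: "(cmod t)\<^sup>2 + (cmod t) ^ 4 / 2 + (cmod t) ^ 6 / 3 \<le> - ln (1 - (cmod t)\<^sup>2)"
    by (simp flip: power_mult) (smt (verit) zero_le_power norm_ge_zero divide_nonneg_pos)
  have p4: "cmod u ^ 4 = (cmod u ^ 2) ^ 2" for u by simp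
  \<comment> \<open>Eight times the increment, with the logarithm cut after |t|^4, is a difference
    of values of 8 F plus squares, the first of them the second difference.\<close>
  have "12 * (cmod t)\<^sup>2 + 6 * (cmod t) ^ 4 - 16 * Re (t * cnj z)
      + 4 * Re (t * cnj y * (1 - z * cnj z)) - 2 * Re (t\<^sup>2 * (cnj z)\<^sup>2) =
      10 * (cmod t)\<^sup>2 + 2 * (cmod z)\<^sup>2 - 8 * Re (t * cnj z) + 3 * (cmod t) ^ 4
      + 2 * (cmod z)\<^sup>2 * (cmod t)\<^sup>2
      - (10 * (cmod z)\<^sup>2 + 2 * (cmod y)\<^sup>2 - 8 * Re (z * cnj y) + 3 * (cmod z) ^ 4
      + 2 * (cmod y)\<^sup>2 * (cmod z)\<^sup>2)
      + 2 * (cmod (t - 2 * z + y))\<^sup>2 + 2 * (cmod z)\<^sup>2 * (cmod (t - y))\<^sup>2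
      + 3 * ((cmod t)\<^sup>2 - (cmod z)\<^sup>2)\<^sup>2 + 4 * (Im (t * cnj z))\<^sup>2"
    unfolding p4 cmod_power2
    by (simp add: power2_eq_square algebra_simps)
  moreover have "0 \<le> 2 * (cmod z)\<^sup>2 * (cmod (t - y))\<^sup>2 + 3 * ((cmod t)\<^sup>2 - (cmod z)\<^sup>2)\<^sup>2
      + 4 * (Im (t * cnj z))\<^sup>2"
    "0 \<le> (cmod t) ^ 6"
    by simp_all
  ultimately show "((cmod (t - 2 * z + y))\<^sup>2 + (cmod t) ^ 6) / 4
      + (5 / 4 * (cmod t)\<^sup>2 + (cmod z)\<^sup>2 / 4 - Re (t * cnj z)
      + 3 / 8 * (cmod t) ^ 4 + (cmod z)\<^sup>2 * (cmod t)\<^sup>2 / 4)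
      - (5 / 4 * (cmod z)\<^sup>2 + (cmod y)\<^sup>2 / 4 - Re (z * cnj y)
      + 3 / 8 * (cmod z) ^ 4 + (cmod y)\<^sup>2 * (cmod z)\<^sup>2 / 4)
      \<le> - 2 * Re (log_coeff_step1 z t)
          + 1 / 2 * Re (log_coeff_step2 y z t) + 0 * Re (log_coeff_step3 x y z t)
          - 3 / 2 * ln (1 - (cmod t)\<^sup>2)"
    using ln unfolding log_coeff_step1_def log_coeff_step2_def minus_complex.sel Re_divide_numeral
    by argo
qed (auto intro!: continuous_intros simp: case_prod_unfold)

lemma sum_rule_local_bound3:
  "sum_rule_local_bound (5 / 2) (- 15 / 4) (3 / 2) (- 1 / 4)
     (\<lambda>x y z t. ((cmod (t - 3 * z + 3 * y - x))\<^sup>2 + (cmod t) ^ 8) / 48)"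
proof -
  have cont: "continuous_on UNIV (\<lambda>(x, y, z). sum_rule_flux3 x y z / 96)"
    unfolding sum_rule_flux3_def case_prod_unfold by (intro continuous_intros) auto
  have "((cmod (t - 3 * z + 3 * y - x))\<^sup>2 + (cmod t) ^ 8) / 48 + sum_rule_flux3 y z t / 96 - sum_rule_flux3 x y z / 96 \<le>
          - 15 / 4 * Re (log_coeff_step1 z t)
          + 3 / 2 * Re (log_coeff_step2 y z t) + - 1 / 4 * Re (log_coeff_step3 x y z t)
          - 5 / 2 * ln (1 - (cmod t)\<^sup>2)"
    if t: "cmod t < 1" for x y z t
  proof -
    define f A B where "f = t - 3 * z + 3 * y - x"
      and "A = x * (y * cnj y) - t * (z * cnj z)" and "B = y\<^sup>2 * cnj z - z\<^sup>2 * cnj y"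
    have "(cmod t)\<^sup>2 < 1" using t by (simp add: abs_square_less_1)
    from neg_ln_one_minus_ge[OF _ this]
    have ln: "(cmod t)\<^sup>2 + (cmod t) ^ 4 / 2 + (cmod t) ^ 6 / 3 + (cmod t) ^ 8 / 4
        \<le> - ln (1 - (cmod t)\<^sup>2)"
      by (simp flip: power_mult)
    \<comment> \<open>2 f is (2 f + 2 A + B) - 2 A - B. Half of the resulting bound is covered by
      the squares with factors 3, 6 and 7 in the identity. This leaves 2 |f|^2, hence the constant 2
      / 96 = 1 / 48.\<close>
    have "(cmod ((2 * f + 2 * A + B) + - (2 * A) + - B))\<^sup>2 \<le>
        3 * ((cmod (2 * f + 2 * A + B))\<^sup>2 + (cmod (- (2 * A)))\<^sup>2 + (cmod (- B))\<^sup>2)"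
      by (rule cmod_sum3_squared_le)
    then have f: "4 * (cmod f)\<^sup>2 \<le>
        3 * (cmod (2 * f + 2 * A + B))\<^sup>2 + 12 * (cmod A)\<^sup>2 + 3 * (cmod B)\<^sup>2"
      by (simp add: norm_mult power_mult_distrib)
    define Q where "Q = 6 * (cmod (y\<^sup>2 * cnj z + z\<^sup>2 * cnj y - x * (y * cnj y) - t * (z * cnj z)))\<^sup>2
       + 40 * (cmod (x * (x * cnj x - y * cnj y)))\<^sup>2 + 40 * (cmod (t * (t * cnj t - z * cnj z)))\<^sup>2
       + 6 * (cmod (y\<^sup>2 - x * y - z\<^sup>2 + y * z))\<^sup>2 + 6 * (cmod (z\<^sup>2 - z * t - y\<^sup>2 + y * z))\<^sup>2
       + 12 * (Re (cnj y * (2 * y - x - z)))\<^sup>2 + 12 * (Re (cnj z * (2 * z - y - t)))\<^sup>2"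
    have "0 \<le> Q" "0 \<le> (cmod (2 * f + 2 * A + B))\<^sup>2" "0 \<le> (cmod B)\<^sup>2" "0 \<le> (cmod t) ^ 8"
      unfolding Q_def by simp_all
    moreover have "240 * (cmod t)\<^sup>2 + 120 * (cmod t) ^ 4 + 80 * (cmod t) ^ 6
      - 360 * Re (log_coeff_step1 z t) + 144 * Re (log_coeff_step2 y z t)
      - 24 * Re (log_coeff_step3 x y z t) =
      sum_rule_flux3 y z t - sum_rule_flux3 x y z + 3 * (cmod (2 * f + 2 * A + B))\<^sup>2
      + 6 * (cmod A)\<^sup>2 + 7 * (cmod B)\<^sup>2 + Q"
      unfolding Q_def A_def B_def f_def
      by (rule trans[OF sum_rule_identity3]) (simp only: add.assoc)
    ultimately show ?thesis
      unfolding f_def[symmetric] using ln f by argo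
  qed
  then show ?thesis
    unfolding sum_rule_local_bound_def using cont by (intro exI[of _ "\<lambda>x y z. sum_rule_flux3 x y z / 96"]) auto
qed

section \<open>Mean values of the logarithm of a polynomial\<close>

lemma minus_i_mult_i: "- \<i> * (\<i> * u) = u"
  by (simp flip: mult.assoc)

text \<open>Cauchy's formula for the k-th derivative: under u = cis t the form du / u^(k+1) turns
  into i cis (- k t) dt.\<close>

lemma integral_circle_negative_mode:
  fixes g :: "complex \<Rightarrow> complex"
  assumes "g holomorphic_on ball 0 R" "1 < R"
  shows "((\<lambda>t. g (cis t) * cis (- (real k * t))) has_integral
           2 * pi * ((deriv ^^ k) g 0 / fact k)) {0..2 * pi}"
proof -
  have "cball 0 1 \<subseteq> (ball 0 R :: complex set)" using assms(2) by auto
  then have "continuous_on (cball 0 1) g" "g holomorphic_on ball 0 1"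
    using assms(1) holomorphic_on_imp_continuous_on holomorphic_on_subset ball_subset_cball
    by (blast, meson holomorphic_on_subset ball_subset_cball order_trans)
  then have "((\<lambda>u. g u / (u - 0) ^ Suc k) has_contour_integral
      2 * pi * \<i> / fact k * (deriv ^^ k) g 0) (circlepath 0 1)"
    by (intro Cauchy_has_contour_integral_higher_derivative_circlepath) auto
  then have "((\<lambda>t. g (0 + 1 * cis t) / (0 + 1 * cis t - 0) ^ Suc k * 1 * \<i> * cis t)
      has_integral 2 * pi * \<i> / fact k * (deriv ^^ k) g 0) {0..2 * pi}"
    unfolding circlepath_def
    by (subst (asm) has_contour_integral_part_circlepath_iff) auto
  moreover have "g (0 + 1 * cis t) / (0 + 1 * cis t - 0) ^ Suc k * 1 * \<i> * cis t =
      \<i> * (g (cis t) * cis (- (real k * t)))" for t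
  proof -
    have "cis (- (real k * t)) = inverse (cis t ^ k)" by (simp only: Complex.DeMoivre cis_inverse)
    then show ?thesis by (simp add: field_simps)
  qed
  ultimately have "((\<lambda>t. \<i> * (g (cis t) * cis (- (real k * t)))) has_integral
      \<i> * (2 * pi * ((deriv ^^ k) g 0 / fact k))) {0..2 * pi}"
    by (simp add: mult_ac)
  from has_integral_mult_right[OF this, of "- \<i>"] show ?thesis
    by (simp only: minus_i_mult_i)
qed

text \<open>For k > 0 the form g(u) u^(k-1) du is holomorphic, so Cauchy's theorem applies; it pulls
  back to i g(cis t) cis (k t) dt.\<close>

lemma integral_circle_positive_mode:
  fixes g :: "complex \<Rightarrow> complex"
  assumes "g holomorphic_on ball 0 R" "1 < R" "0 < k"
  shows "((\<lambda>t. g (cis t) * cis (real k * t)) has_integral 0) {0..2 * pi}"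
proof -
  have "((\<lambda>u. g u * u ^ (k - 1)) has_contour_integral 0) (circlepath 0 1)"
    by (rule Cauchy_theorem_convex_simple[of _ "ball 0 R"])
      (use assms in \<open>auto intro!: holomorphic_intros\<close>)
  then have "((\<lambda>t. g (0 + 1 * cis t) * (0 + 1 * cis t) ^ (k - 1) * 1 * \<i> * cis t)
      has_integral 0) {0..2 * pi}"
    unfolding circlepath_def
    by (subst (asm) has_contour_integral_part_circlepath_iff) auto
  moreover have "g (0 + 1 * cis t) * (0 + 1 * cis t) ^ (k - 1) * 1 * \<i> * cis t =
      \<i> * (g (cis t) * cis (real k * t))" for t
  proof -
    have "cis (real k * t) = cis t ^ (k - 1) * cis t"
      using assms(3) by (metis Complex.DeMoivre power_minus_mult)
    then show ?thesis by simp
  qed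
  ultimately have "((\<lambda>t. \<i> * (g (cis t) * cis (real k * t))) has_integral \<i> * 0) {0..2 * pi}"
    by (simp only: mult_zero_right)
  from has_integral_mult_right[OF this, of "- \<i>"] show ?thesis
    by (simp only: minus_i_mult_i)
qed

section \<open>Taylor coefficients of the logarithm of a polynomial\<close>

lemma has_fps_expansion_poly:
  fixes p :: "complex poly"
  shows "poly p has_fps_expansion fps_of_poly p"
proof (induction p)
  case 0
  then show ?case by simp
next
  case (pCons a p)
  have "(\<lambda>z. a + z * poly p z) has_fps_expansion fps_const a + fps_X * fps_of_poly p"
    by (intro fps_expansion_intros pCons.IH)
  then show ?case by (simp add: fps_of_poly_pCons algebra_simps)
qed

text \<open>For \<open>p\<close> with \<open>p(0) = 1\<close>, the Taylor coefficients of \<open>log p\<close> at the origin. Only orders up to 3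
  are correct: the value is \<open>0\<close> from order 4 on.\<close>

definition log_coeff :: "complex poly \<Rightarrow> nat \<Rightarrow> complex" where
  "log_coeff p k =
    (if k = 1 then coeff p 1
     else if k = 2 then coeff p 2 - (coeff p 1)\<^sup>2 / 2
     else if k = 3 then coeff p 3 - coeff p 1 * coeff p 2 + (coeff p 1) ^ 3 / 3 else 0)"

text \<open>Differentiating exp g = p gives g' p = p'. Its coefficients of orders 0, 1, 2 determine
  those of g of orders 1, 2, 3 in turn, whichever branch \<open>g\<close> is.\<close>

lemma higher_deriv_log_poly:
  assumes "g holomorphic_on ball 0 R" "0 < R" "\<And>z. z \<in> ball 0 R \<Longrightarrow> exp (g z) = poly p z"
    and p0: "coeff p 0 = 1" and k: "k \<in> {1, 2, 3}"
  shows "(deriv ^^ k) g 0 / fact k = log_coeff p k"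
proof -
  define G where "G = fps_expansion g 0"
  have G: "g has_fps_expansion G"
    unfolding G_def by (rule has_fps_expansion_fps_expansion[of "ball 0 R"]) (use assms in auto)
  have P: "poly p has_fps_expansion fps_of_poly p" by (rule has_fps_expansion_poly)
  have prod: "(\<lambda>z. deriv g z * poly p z) has_fps_expansion fps_deriv G * fps_of_poly p"
    by (intro fps_expansion_intros G P)
  have ev: "\<forall>\<^sub>F z in nhds 0. deriv g z * poly p z = deriv (poly p) z"
  proof -
    have "\<forall>\<^sub>F z in nhds 0. z \<in> ball (0::complex) R"
      using assms(2) by (intro eventually_nhds_in_open) auto
    then show ?thesis
    proof eventually_elim
      case (elim z)
      then have "(g has_field_derivative deriv g z) (at z)"
        using assms(1) holomorphic_derivI by blast
      then have "((\<lambda>z. exp (g z)) has_field_derivative exp (g z) * deriv g z) (at z)"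
        by (auto intro!: derivative_eq_intros)
      then have "(poly p has_field_derivative exp (g z) * deriv g z) (at z)"
        by (rule has_field_derivative_transform_within_open[where S = "ball 0 R"])
          (use elim assms(3) in auto)
      from DERIV_imp_deriv[OF this] show ?case using assms(3)[OF elim] by simp
    qed
  qed
  have "deriv (poly p) has_fps_expansion fps_deriv G * fps_of_poly p"
    using prod has_fps_expansion_cong[OF ev refl] by simp
  moreover have "deriv (poly p) has_fps_expansion fps_deriv (fps_of_poly p)"
    by (intro fps_expansion_intros P)
  ultimately have eq: "fps_deriv G * fps_of_poly p = fps_deriv (fps_of_poly p)"
    by (rule fps_expansion_unique_complex)
  have nth: "fps_nth (fps_deriv G * fps_of_poly p) n = fps_nth (fps_deriv (fps_of_poly p)) n" for n
    by (simp add: eq)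
  have g1: "fps_nth G 1 = coeff p 1"
    using nth[of 0] p0 by simp
  have g2: "2 * fps_nth G 2 + coeff p 1 * coeff p 1 = 2 * coeff p 2"
    using nth[of 1] p0 g1 by (simp add: fps_mult_nth numeral_2_eq_2 add.commute)
  have g3: "3 * fps_nth G 3 + 2 * fps_nth G 2 * coeff p 1 + coeff p 1 * coeff p 2 = 3 * coeff p 3"
    using nth[of 2] p0 g1 by (simp add: fps_mult_nth numeral_2_eq_2 numeral_3_eq_3 algebra_simps)
  have g2': "fps_nth G 2 = coeff p 2 - (coeff p 1)\<^sup>2 / 2"
    using g2 by (simp add: field_simps power2_eq_square)
  have g3': "fps_nth G 3 = coeff p 3 - coeff p 1 * coeff p 2 + (coeff p 1) ^ 3 / 3"
  proof -
    have "3 * fps_nth G 3 = 3 * coeff p 3 - 3 * coeff p 1 * coeff p 2 + (coeff p 1) ^ 3"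
      using g2 g3 by algebra
    then show ?thesis by (simp add: field_simps)
  qed
  show ?thesis
    using k g1 g2' g3' fps_nth_fps_expansion[OF G, of k] unfolding log_coeff_def by auto
qed

text \<open>There are finitely many roots, all outside the closed disk, so the least modulus of a
  root serves as \<open>R\<close>. The margin beyond 1 gives a holomorphic logarithm on a
  neighbourhood of the closed disk.\<close>

lemma poly_zero_free_ball:
  fixes p :: "complex poly"
  assumes "\<And>z. cmod z \<le> 1 \<Longrightarrow> poly p z \<noteq> 0"
  obtains R where "1 < R" "\<And>z. z \<in> ball 0 R \<Longrightarrow> poly p z \<noteq> 0"
proof (cases "\<exists>z. poly p z = 0")
  case False
  then show ?thesis using that[of 2] by auto
next
  case True
  have "p \<noteq> 0" using assms[of 0] by auto
  then have fin: "finite {z. poly p z = 0}" by (rule poly_roots_finite)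
  define R where "R = Min (cmod ` {z. poly p z = 0})"
  have "R \<in> cmod ` {z. poly p z = 0}"
    unfolding R_def using fin True by (intro Min_in) auto
  then have "1 < R" using assms by force
  moreover have "poly p z \<noteq> 0" if "z \<in> ball 0 R" for z
  proof
    assume "poly p z = 0"
    then have "R \<le> cmod z" unfolding R_def using fin by (intro Min_le) auto
    then show False using that by simp
  qed
  ultimately show ?thesis using that by blast
qed

text \<open>With g a holomorphic logarithm of p and k > 0, the integrand is the real part of g times
  cis (k t) + cis (- k t). The first mode integrates to 0, the second to 2 pi times the k-th Taylor
  coefficient of g.\<close>

lemma integral_cos_mode_log_poly:
  assumes zf: "\<And>z. cmod z \<le> 1 \<Longrightarrow> poly p z \<noteq> 0" and p0: "coeff p 0 = 1"
    and k: "k \<in> {0, 1, 2, 3}"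
  shows "((\<lambda>t. cos (real k * t) * ln ((cmod (poly p (cis t)))\<^sup>2)) has_integral
           2 * pi * Re (log_coeff p k)) {0..2 * pi}"
proof -
  obtain R where R: "1 < R" "\<And>z. z \<in> ball 0 R \<Longrightarrow> poly p z \<noteq> 0"
    using poly_zero_free_ball zf by blast
  obtain g where g: "g holomorphic_on ball 0 R" "\<And>z. z \<in> ball 0 R \<Longrightarrow> exp (g z) = poly p z"
    by (rule holomorphic_logarithm_exists[of "ball 0 R" "poly p" 0])
      (use R in \<open>auto intro!: holomorphic_intros\<close>)
  have ln: "ln ((cmod (poly p (cis t)))\<^sup>2) = 2 * Re (g (cis t))" for t
  proof -
    have "cmod (poly p (cis t)) = exp (Re (g (cis t)))"
      using g(2)[of "cis t"] R(1) norm_exp_eq_Re[of "g (cis t)"] by simp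
    then show ?thesis by (simp add: ln_realpow)
  qed
  have neg: "((\<lambda>t. g (cis t) * cis (- (real k * t))) has_integral
           2 * pi * ((deriv ^^ k) g 0 / fact k)) {0..2 * pi}"
    by (rule integral_circle_negative_mode[OF g(1) R(1)])
  show ?thesis
  proof (cases "k = 0")
    case True
    \<comment> \<open>The branch leaves \<open>g 0\<close> a multiple of 2 pi i, so the mean of Re g
      is 0; this agrees with the default value \<open>log_coeff p 0 = 0\<close>.\<close>
    have "exp (g 0) = 1" using g(2)[of 0] R(1) p0 by (simp add: poly_0_coeff_0)
    then have "Re (g 0) = 0"
      by (metis norm_exp_eq_Re exp_eq_one_iff norm_one)
    moreover have "((\<lambda>t. Re (g (cis t))) has_integral Re (2 * pi * g 0)) {0..2 * pi}"
      using has_integral_linear[OF neg bounded_linear_Re] True by (simp add: o_def)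
    ultimately have "((\<lambda>t. Re (g (cis t))) has_integral 0) {0..2 * pi}" by simp
    from has_integral_mult_right[OF this, of 2] have "((\<lambda>t. 2 * Re (g (cis t))) has_integral 0) {0..2 * pi}"
      by simp
    then show ?thesis unfolding ln using True by (simp add: log_coeff_def)
  next
    case False
    have "((\<lambda>t. g (cis t) * cis (- (real k * t)) + g (cis t) * cis (real k * t)) has_integral
        2 * pi * log_coeff p k + 0) {0..2 * pi}"
    proof (rule has_integral_add)
      have "(deriv ^^ k) g 0 / fact k = log_coeff p k"
        using higher_deriv_log_poly[OF g(1) _ g(2) p0, of k] R(1) k False by simp
      with neg show "((\<lambda>t. g (cis t) * cis (- (real k * t))) has_integral
          2 * pi * log_coeff p k) {0..2 * pi}" by simp
    qed (use integral_circle_positive_mode[OF g(1) R(1), of k] False in simp)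
    from has_integral_linear[OF this bounded_linear_Re]
    show ?thesis
      unfolding ln by (simp add: o_def algebra_simps)
  qed
qed

section \<open>The Szego recurrence\<close>

text \<open>The components of the pair are \<open>\<Phi>\<^sub>n\<close> and \<open>\<Phi>\<^sub>n\<^sup>*\<close>.\<close>

primrec szego_polys :: "(nat \<Rightarrow> complex) \<Rightarrow> nat \<Rightarrow> complex poly \<times> complex poly" where
  "szego_polys \<alpha> 0 = (1, 1)"
| "szego_polys \<alpha> (Suc n) =
     (pCons 0 (fst (szego_polys \<alpha> n)) - smult (cnj (\<alpha> n)) (snd (szego_polys \<alpha> n)),
      snd (szego_polys \<alpha> n) - smult (\<alpha> n) (pCons 0 (fst (szego_polys \<alpha> n))))"

abbreviation "szego_poly \<alpha> n \<equiv> fst (szego_polys \<alpha> n)"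
abbreviation "szego_rev \<alpha> n \<equiv> snd (szego_polys \<alpha> n)"

lemma coeff_szego_rev_0 [simp]: "coeff (szego_rev \<alpha> n) 0 = 1"
  by (induction n) auto

lemma degree_szego_polys: "degree (szego_poly \<alpha> n) \<le> n \<and> degree (szego_rev \<alpha> n) \<le> n"
proof (induction n)
  case (Suc n)
  have "degree (pCons 0 (szego_poly \<alpha> n)) \<le> Suc n"
    using degree_pCons_le[of 0 "szego_poly \<alpha> n"] Suc by linarith
  moreover have "degree (smult c (szego_rev \<alpha> n)) \<le> Suc n" for c
    using degree_smult_le[of c "szego_rev \<alpha> n"] Suc by linarith
  ultimately show ?case
    using Suc degree_smult_le[of "\<alpha> n" "pCons 0 (szego_poly \<alpha> n)"]
    by (auto intro!: degree_diff_le)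
qed simp

text \<open>On the circle 1 / cnj z = z, so this identifies the second component with the reversed
  polynomial. The induction needs only z cnj z = 1.\<close>

lemma szego_rev_on_circle:
  assumes "cmod z = 1"
  shows "poly (szego_rev \<alpha> n) z = z ^ n * cnj (poly (szego_poly \<alpha> n) z)"
proof (induction n)
  case (Suc n)
  have "z * cnj z = 1" using assms complex_norm_square[of z] by simp
  then have cancel: "z * (cnj z * u) = u" "z ^ n * (cnj z ^ n * u) = u" for u
    by (simp_all flip: mult.assoc power_mult_distrib)
  show ?case
    by (simp add: Suc algebra_simps cancel)
qed simp

lemma cmod_szego_rev_on_circle:
  "cmod z = 1 \<Longrightarrow> cmod (poly (szego_rev \<alpha> n) z) = cmod (poly (szego_poly \<alpha> n) z)"
  by (simp add: szego_rev_on_circle norm_mult norm_power)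

text \<open>Both claims go through one induction, because domination at n excludes a zero at n + 1.
  Zero-freeness on the closed disk is what allows a logarithm of the reversed polynomial.\<close>

lemma szego_rev_dominates:
  assumes \<alpha>: "\<And>n. cmod (\<alpha> n) < 1" and z: "cmod z \<le> 1"
  shows "cmod (poly (szego_poly \<alpha> n) z) \<le> cmod (poly (szego_rev \<alpha> n) z) \<and>
         poly (szego_rev \<alpha> n) z \<noteq> 0"
proof (induction n)
  case (Suc n)
  define p q a where "p = poly (szego_poly \<alpha> n) z" and "q = poly (szego_rev \<alpha> n) z"
    and "a = \<alpha> n"
  have IH: "cmod p \<le> cmod q" "q \<noteq> 0" using Suc by (auto simp: p_def q_def)
  have zp: "cmod (z * p) \<le> cmod q"
    using mult_mono[OF z IH(1)] by (simp add: norm_mult)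
  have a: "cmod a < 1" using \<alpha> by (simp add: a_def)
  \<comment> \<open>The Moebius identity: (z p - cnj a q) / (q - a z p) is a disk automorphism
    applied to z p / q.\<close>
  have "(cmod (q - a * (z * p)))\<^sup>2 - (cmod (z * p - cnj a * q))\<^sup>2 =
      (1 - (cmod a)\<^sup>2) * ((cmod q)\<^sup>2 - (cmod (z * p))\<^sup>2)"
    unfolding cmod_power2 by (simp add: power2_eq_square algebra_simps)
  also have "\<dots> \<ge> 0"
    using a zp by (intro mult_nonneg_nonneg) (simp_all add: abs_square_le_1)
  finally have "cmod (z * p - cnj a * q) \<le> cmod (q - a * (z * p))"
    by (simp add: power2_le_iff_abs_le)
  moreover have "q - a * (z * p) \<noteq> 0"
  proof
    assume "q - a * (z * p) = 0"
    then have "cmod q = cmod a * cmod (z * p)" by (simp add: norm_mult)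
    also have "\<dots> \<le> cmod a * cmod q" using zp by (intro mult_left_mono) auto
    also have "\<dots> < 1 * cmod q" using a IH(2) by (intro mult_strict_right_mono) auto
    finally show False by simp
  qed
  ultimately show ?case by (simp add: p_def q_def a_def mult.left_commute)
qed simp

text \<open>Unrolling the recurrence from index j expresses everything through four coefficients and
  the low-order coefficients of the two polynomials at j; the latter cancel. Counting up from j
  avoids truncated subtraction.\<close>

lemma log_coeff_szego_rev_Suc:
  fixes \<alpha> :: "nat \<Rightarrow> complex" and j :: nat
  defines "L \<equiv> \<lambda>n. log_coeff (szego_rev \<alpha> n)"
  defines "x \<equiv> \<alpha> j" and "y \<equiv> \<alpha> (Suc j)" and "z \<equiv> \<alpha> (Suc (Suc j))" and "t \<equiv> \<alpha> (Suc (Suc (Suc j)))"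
  defines "n \<equiv> Suc (Suc (Suc j))"
  shows "L (Suc n) 1 - L n 1 = log_coeff_step1 z t"
    and "L (Suc n) 2 - L n 2 = log_coeff_step2 y z t"
    and "L (Suc n) 3 - L n 3 = log_coeff_step3 x y z t"
proof -
  define p q where "p = coeff (szego_poly \<alpha> j)" and "q = coeff (szego_rev \<alpha> j)"
  have q0: "q 0 = 1" by (simp add: q_def)
  have c2: "coeff r 2 = coeff r (Suc (Suc 0))" and c3: "coeff r 3 = coeff r (Suc (Suc (Suc 0)))"
    for r :: "complex poly"
    by (simp_all add: numeral_2_eq_2 numeral_3_eq_3)
  note defs = L_def n_def log_coeff_def log_coeff_step1_def log_coeff_step2_def log_coeff_step3_def
  show "L (Suc n) 1 - L n 1 = log_coeff_step1 z t"
    by (simp add: defs c2 c3 q0 flip: p_def q_def x_def y_def z_def t_def)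
  \<comment> \<open>The fractions are again atoms, so that \<open>algebra\<close> faces polynomial
    identities.\<close>
  define h where "h = (1/2 :: complex)"
  have h: "2 * h = 1" "u / 2 = u * h" for u :: complex by (simp_all add: h_def)
  define k where "k = (1/3 :: complex)"
  have k: "3 * k = 1" "u / 3 = u * k" for u :: complex by (simp_all add: k_def)
  show "L (Suc n) 2 - L n 2 = log_coeff_step2 y z t"
    using h(1)
    by (simp add: defs c2 c3 q0 h(2) flip: p_def q_def x_def y_def z_def t_def) algebra
  show "L (Suc n) 3 - L n 3 = log_coeff_step3 x y z t"
    using k(1)
    by (simp add: defs c2 c3 q0 k(2) flip: p_def q_def x_def y_def z_def t_def) algebra
qed

section \<open>Orthogonal polynomials and their norms\<close>

lemma infinite_unit_circle: "infinite (sphere (0::complex) 1)"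
proof
  assume "finite (sphere (0::complex) 1)"
  moreover have "connected (sphere (0::complex) 1)" by (rule connected_sphere) simp
  ultimately obtain a where "sphere (0::complex) 1 \<subseteq> {a}"
    using connected_finite_iff_sing by (metis empty_subsetI subset_refl)
  moreover have "1 \<in> sphere (0::complex) 1" "-1 \<in> sphere (0::complex) 1" by auto
  ultimately have "(1::complex) = - 1" by blast
  then show False by simp
qed

lemma poly_eq_if_eq_on_circle:
  fixes p q :: "complex poly"
  assumes "\<And>z. cmod z = 1 \<Longrightarrow> poly p z = poly q z"
  shows "p = q"
proof (rule ccontr)
  assume "p \<noteq> q"
  then have "finite {z. poly (p - q) z = 0}" by (intro poly_roots_finite) simp
  moreover have "sphere 0 1 \<subseteq> {z. poly (p - q) z = 0}" using assms by auto
  ultimately show False using infinite_unit_circle finite_subset by blast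
qed

text \<open>On the circle \<open>reversed\<close> agrees with \<open>szego_rev\<close>, so by
  induction both families satisfy the same recurrence there, and a polynomial is determined by its
  values on this infinite set.\<close>

lemma verblunsky_imp_szego_polys:
  assumes "verblunsky_coeffs \<mu> \<alpha>"
  shows "monic_orthogonal_polys \<mu> (szego_poly \<alpha>)"
proof -
  obtain \<Phi> where \<Phi>: "monic_orthogonal_polys \<mu> \<Phi>"
    and rec: "\<And>n z. z \<noteq> 0 \<Longrightarrow>
      poly (\<Phi> (Suc n)) z = z * poly (\<Phi> n) z - cnj (\<alpha> n) * reversed n (\<Phi> n) z"
    using assms unfolding verblunsky_coeffs_def by blast
  have "\<Phi> n = szego_poly \<alpha> n" for n
  proof (induction n)
    case 0
    have "degree (\<Phi> 0) = 0" "lead_coeff (\<Phi> 0) = 1"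
      using \<Phi> unfolding monic_orthogonal_polys_def by blast+
    then show ?case by (metis degree_0_id one_pCons szego_polys.simps(1) fst_conv)
  next
    case (Suc n)
    show ?case
    proof (rule poly_eq_if_eq_on_circle)
      fix z :: complex assume z: "cmod z = 1"
      then have "z * cnj z = 1" using complex_norm_square[of z] by simp
      then have "1 / cnj z = z" by (metis nonzero_eq_divide_eq mult_zero_right zero_neq_one)
      then have "reversed n (\<Phi> n) z = poly (szego_rev \<alpha> n) z"
        using szego_rev_on_circle[OF z] Suc by (simp add: reversed_def)
      moreover have "z \<noteq> 0" using z by auto
      ultimately show "poly (\<Phi> (Suc n)) z = poly (szego_poly \<alpha> (Suc n)) z"
        using rec[of z n] Suc by simp
    qed
  qed
  then have "\<Phi> = szego_poly \<alpha>" by auto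
  with \<Phi> show ?thesis by simp
qed

lemma circle_measure_integrable:
  fixes f :: "complex \<Rightarrow> 'b::{banach, second_countable_topology}"
  assumes "prob_space \<mu>" "sets \<mu> = sets circle_borel" "continuous_on UNIV f"
  shows "integrable \<mu> f"
proof -
  interpret prob_space \<mu> by fact
  have sp: "space \<mu> = sphere 0 1"
    using sets_eq_imp_space_eq[OF assms(2)] by (simp add: circle_borel_def space_restrict_space)
  have "f \<in> borel_measurable borel"
    using assms(3) by (rule borel_measurable_continuous_onI)
  then have "f \<in> borel_measurable circle_borel"
    unfolding circle_borel_def by (rule measurable_restrict_space1)
  then have m: "f \<in> borel_measurable \<mu>"
    using assms(2) measurable_cong_sets by blast
  have "bounded (f ` sphere 0 1)"
    using assms(3) by (intro compact_imp_bounded compact_continuous_image)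
      (auto intro: continuous_on_subset)
  then obtain B where "\<And>z. z \<in> sphere 0 1 \<Longrightarrow> norm (f z) \<le> B"
    unfolding bounded_iff by blast
  then show ?thesis
    using sp m by (intro integrable_const_bound[of _ B]) auto
qed

text \<open>Induction on d, subtracting a multiple of the monic polynomial of degree d to cancel the
  top coefficient. Bounding coefficients rather than the degree makes d = 0 the case of the zero
  polynomial.\<close>

lemma orthogonal_to_lower_degree:
  assumes \<mu>: "prob_space \<mu>" "sets \<mu> = sets circle_borel"
    and \<Phi>: "monic_orthogonal_polys \<mu> \<Phi>"
    and p: "\<And>i. i \<ge> d \<Longrightarrow> coeff p i = 0" and "d \<le> n"
  shows "(LINT z|\<mu>. poly (\<Phi> n) z * cnj (poly p z)) = 0"
  using p \<open>d \<le> n\<close>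
proof (induction d arbitrary: p)
  case 0
  then have "p = 0" by (simp add: poly_eq_iff)
  then show ?case by simp
next
  case (Suc d)
  define r where "r = p - smult (coeff p d) (\<Phi> d)"
  have deg: "degree (\<Phi> d) = d" "coeff (\<Phi> d) d = 1"
    using \<Phi> unfolding monic_orthogonal_polys_def by (metis, metis)
  have "coeff r i = 0" if "i \<ge> d" for i
    using that Suc.prems(1)[of i] deg coeff_eq_0[of "\<Phi> d" i]
    by (cases "i = d") (auto simp: r_def)
  then have r0: "(LINT z|\<mu>. poly (\<Phi> n) z * cnj (poly r z)) = 0"
    using Suc by simp
  have int: "integrable \<mu> (\<lambda>z. poly (\<Phi> n) z * cnj (poly q z))" for q
    by (rule circle_measure_integrable[OF \<mu>]) (intro continuous_intros)
  have "(LINT z|\<mu>. poly (\<Phi> n) z * cnj (poly p z)) =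
      (LINT z|\<mu>. poly (\<Phi> n) z * cnj (poly r z)
        + cnj (coeff p d) * (poly (\<Phi> n) z * cnj (poly (\<Phi> d) z)))"
    by (simp add: r_def algebra_simps)
  also have "\<dots> = (LINT z|\<mu>. poly (\<Phi> n) z * cnj (poly r z))
        + cnj (coeff p d) * (LINT z|\<mu>. poly (\<Phi> n) z * cnj (poly (\<Phi> d) z))"
    by (subst Bochner_Integration.integral_add) (use int in auto)
  also have "(LINT z|\<mu>. poly (\<Phi> n) z * cnj (poly (\<Phi> d) z)) = 0"
    using \<Phi> Suc.prems(2) unfolding monic_orthogonal_polys_def by auto
  finally show ?case using r0 by simp
qed

text \<open>Pythagoras: z Phi_n is Phi_(n+1) plus cnj alpha_n times the reversed polynomial. The
  latter has degree at most n, hence is orthogonal to Phi_(n+1), and on the circle it has the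
  modulus of Phi_n.\<close>

lemma szego_poly_norm_Suc:
  assumes \<mu>: "prob_space \<mu>" "sets \<mu> = sets circle_borel"
    and orth: "monic_orthogonal_polys \<mu> (szego_poly \<alpha>)"
  defines "N \<equiv> \<lambda>n. (LINT z|\<mu>. (cmod (poly (szego_poly \<alpha> n) z))\<^sup>2)"
  shows "N (Suc n) = (1 - (cmod (\<alpha> n))\<^sup>2) * N n"
proof -
  have sp: "space \<mu> = sphere 0 1"
    using sets_eq_imp_space_eq[OF \<mu>(2)] by (simp add: circle_borel_def space_restrict_space)
  define p q r where "p = poly (szego_poly \<alpha> n)" and "q = poly (szego_rev \<alpha> n)"
    and "r = poly (szego_poly \<alpha> (Suc n))"
  define g where "g = (\<lambda>z. Re (\<alpha> n * (r z * cnj (q z))))"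
  have cont: "continuous_on UNIV p" "continuous_on UNIV q" "continuous_on UNIV r"
    unfolding p_def q_def r_def by (intro continuous_intros)+
  have int: "integrable \<mu> (\<lambda>z. (cmod (p z))\<^sup>2)" "integrable \<mu> (\<lambda>z. (cmod (r z))\<^sup>2)"
    "integrable \<mu> (\<lambda>z. r z * cnj (q z))"
    by (rule circle_measure_integrable[OF \<mu>]; intro continuous_intros cont)+
  have "(LINT z|\<mu>. r z * cnj (q z)) = 0"
    unfolding r_def q_def
    using degree_szego_polys[of \<alpha> n]
    by (intro orthogonal_to_lower_degree[OF \<mu> orth, of "Suc n"] coeff_eq_0) auto
  then have zero: "(LINT z|\<mu>. g z) = 0"
    using integral_Re[of \<mu> "\<lambda>z. \<alpha> n * (r z * cnj (q z))"] int(3) unfolding g_def by simp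
  have int_g: "integrable \<mu> g"
    unfolding g_def using int(3) by (intro integrable_Re integrable_mult_right)
  have "N n = (LINT z|\<mu>. (cmod (r z))\<^sup>2 + (cmod (\<alpha> n))\<^sup>2 * (cmod (p z))\<^sup>2
      + 2 * g z)"
    unfolding N_def
  proof (rule Bochner_Integration.integral_cong[OF refl])
    fix z assume "z \<in> space \<mu>"
    then have z: "cmod z = 1" using sp by simp
    have "(cmod (poly (szego_poly \<alpha> n) z))\<^sup>2 = (cmod (r z + cnj (\<alpha> n) * q z))\<^sup>2"
      using z by (simp add: r_def q_def norm_mult)
    also have "\<dots> = (cmod (r z))\<^sup>2 + (cmod (\<alpha> n))\<^sup>2 * (cmod (q z))\<^sup>2
      + 2 * Re (\<alpha> n * (r z * cnj (q z)))"
      unfolding cmod_power2 by (simp add: power2_eq_square algebra_simps)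
    also have "cmod (q z) = cmod (p z)"
      unfolding p_def q_def using z by (rule cmod_szego_rev_on_circle)
    finally show "(cmod (poly (szego_poly \<alpha> n) z))\<^sup>2 = (cmod (r z))\<^sup>2
      + (cmod (\<alpha> n))\<^sup>2 * (cmod (p z))\<^sup>2 + 2 * g z" unfolding g_def .
  qed
  also have "\<dots> = N (Suc n) + (cmod (\<alpha> n))\<^sup>2 * N n"
    unfolding N_def p_def[symmetric] r_def[symmetric] using int zero int_g by simp
  finally show ?thesis by (simp add: algebra_simps)
qed

text \<open>A vanishing norm would confine the support to the finitely many roots.\<close>

lemma szego_poly_norm_pos:
  assumes \<mu>: "nontrivial_prob_on_circle \<mu>" and orth: "monic_orthogonal_polys \<mu> \<Phi>"
  shows "0 < (LINT z|\<mu>. (cmod (poly (\<Phi> n) z))\<^sup>2)"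
proof -
  have P: "prob_space \<mu>" "sets \<mu> = sets circle_borel" "infinite (measure_support \<mu>)"
    using \<mu> by (auto simp: nontrivial_prob_on_circle_def)
  have int: "integrable \<mu> (\<lambda>z. (cmod (poly (\<Phi> n) z))\<^sup>2)"
    by (rule circle_measure_integrable[OF P(1,2)]) (intro continuous_intros)
  have "(LINT z|\<mu>. (cmod (poly (\<Phi> n) z))\<^sup>2) \<noteq> 0"
  proof
    assume "(LINT z|\<mu>. (cmod (poly (\<Phi> n) z))\<^sup>2) = 0"
    then have "AE z in \<mu>. poly (\<Phi> n) z = 0"
      using integral_nonneg_eq_0_iff_AE[OF int] by simp
    define U where "U = {z. poly (\<Phi> n) z \<noteq> 0}"
    have "open U"
      unfolding U_def by (intro open_Collect_neq continuous_intros)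
    have "U \<inter> space \<mu> \<in> sets \<mu>"
      unfolding P(2) circle_borel_def using \<open>open U\<close> sets_eq_imp_space_eq[OF P(2)]
      by (auto simp: circle_borel_def space_restrict_space sets_restrict_space)
    then have "emeasure \<mu> (U \<inter> space \<mu>) = 0"
      using \<open>AE z in \<mu>. _\<close> AE_iff_measurable[of "U \<inter> space \<mu>" \<mu> "\<lambda>z. poly (\<Phi> n) z = 0"]
      by (auto simp: U_def)
    then have "measure_support \<mu> \<subseteq> {z. poly (\<Phi> n) z = 0}"
      using \<open>open U\<close> unfolding measure_support_def U_def by force
    moreover have "\<Phi> n \<noteq> 0"
      using orth unfolding monic_orthogonal_polys_def by (metis leading_coeff_0_iff zero_neq_one)
    ultimately show False using P(3) poly_roots_finite finite_subset by metis
  qed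
  moreover have "0 \<le> (LINT z|\<mu>. (cmod (poly (\<Phi> n) z))\<^sup>2)" by (rule integral_nonneg_AE) simp
  ultimately show ?thesis by (metis order_le_less)
qed

section \<open>Entropy bound\<close>

lemma sets_angle_measure [measurable_cong, simp]: "sets angle_measure = sets borel"
  by (simp add: angle_measure_def)

lemma space_angle_measure [simp]: "space angle_measure = UNIV"
  by (simp add: angle_measure_def)

lemma prob_space_angle_measure: "prob_space angle_measure"
  unfolding angle_measure_def by (rule prob_space_uniform_measure) simp_all

lemma AE_angle_measure: "AE \<theta> in angle_measure. \<theta> \<in> {0..<2 * pi}"
  unfolding angle_measure_def by (rule AE_uniform_measureI) simp_all

text \<open>Passes from the gauge integral over the closed interval to the normalized measure on the
  half-open one; the extra endpoint is a null set.\<close>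

lemma has_integral_imp_angle_integral:
  fixes f :: "real \<Rightarrow> real"
  assumes f: "continuous_on UNIV f" and I: "(f has_integral 2 * pi * I) {0..2 * pi}"
  shows "integrable angle_measure f" "(LINT \<theta>|angle_measure. f \<theta>) = I"
proof -
  have eq: "angle_measure = density lborel (\<lambda>x. ennreal (indicator {0..2 * pi} x / (2 * pi)))"
    unfolding angle_measure_def uniform_measure_def
  proof (rule density_cong)
    show "AE x in lborel. indicator {0..<2 * pi} x / emeasure lborel {0..<2 * pi} =
        ennreal (indicator {0..2 * pi} x / (2 * pi))"
      using AE_lborel_singleton[of "2 * pi"]
    proof eventually_elim
      case (elim x)
      have "emeasure lborel {0..<2 * pi} = ennreal (2 * pi)" by simp
      moreover have "ennreal 1 / ennreal (2 * pi) = ennreal (1 / (2 * pi))"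
        by (rule divide_ennreal) auto
      ultimately show ?case using elim by (auto simp: indicator_def)
    qed
  qed simp_all
  have m: "f \<in> borel_measurable lborel"
    using f by (simp add: borel_measurable_continuous_onI)
  have si: "set_integrable lborel {0..2 * pi} f"
    using f by (intro borel_integrable_atLeastAtMost') (auto intro: continuous_on_subset)
  then have int: "integrable lborel (\<lambda>x. indicator {0..2 * pi} x / (2 * pi) * f x)"
    unfolding set_integrable_def using integrable_mult_right[of "1 / (2 * pi)"] by fastforce
  then show "integrable angle_measure f"
    unfolding eq using m by (subst integrable_density) auto
  have "(LINT \<theta>|angle_measure. f \<theta>) = (LINT x|lborel. indicator {0..2 * pi} x / (2 * pi) * f x)"
    unfolding eq using m by (subst integral_density) auto
  also have "\<dots> = (LINT x|lborel. 1 / (2 * pi) * (indicator {0..2 * pi} x * f x))"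
    by (rule Bochner_Integration.integral_cong) auto
  also have "\<dots> = 1 / (2 * pi) * (LINT x:{0..2 * pi}|lborel. f x)"
    unfolding set_lebesgue_integral_def by simp
  also have "(LINT x:{0..2 * pi}|lborel. f x) = integral {0..2 * pi} f"
    using set_borel_integral_eq_integral[OF si] by simp
  also have "\<dots> = 2 * pi * I" using I by (rule integral_unique)
  finally show "(LINT \<theta>|angle_measure. f \<theta>) = I" by simp
qed

lemma angle_integrable:
  fixes f :: "real \<Rightarrow> real"
  assumes "continuous_on UNIV f"
  shows "integrable angle_measure f"
proof -
  have "f integrable_on {0..2 * pi}"
    using assms by (intro integrable_continuous_interval) (auto intro: continuous_on_subset)
  then have "(f has_integral 2 * pi * (integral {0..2 * pi} f / (2 * pi))) {0..2 * pi}"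
    by (simp add: has_integral_integral)
  from has_integral_imp_angle_integral(1)[OF assms this] show ?thesis .
qed

lemma angle_integral_cos: "(LINT \<theta>|angle_measure. cos (real k * \<theta>)) = (if k = 0 then 1 else 0)"
proof (rule has_integral_imp_angle_integral(2))
  have "((\<lambda>t. 1 * cis (- (real k * t))) has_integral
      2 * pi * ((deriv ^^ k) (\<lambda>_. 1 :: complex) 0 / fact k)) {0..2 * pi}"
    by (rule integral_circle_negative_mode[of "\<lambda>_. 1" 2]) auto
  from has_integral_linear[OF this bounded_linear_Re]
  show "((\<lambda>t. cos (real k * t)) has_integral 2 * pi * (if k = 0 then 1 else 0)) {0..2 * pi}"
    by (cases "k = 0") (auto simp: o_def)
qed (intro continuous_intros)

text \<open>Dropping the singular part leaves a measure below the original one; the rest is a change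
  of variables along \<open>cis\<close>.\<close>

lemma abs_continuous_part_le:
  assumes dec: "lebesgue_decomposition \<mu> w \<mu>s" and \<mu>: "sets \<mu> = sets circle_borel"
    and f: "f \<in> borel_measurable borel"
  shows "(\<integral>\<^sup>+ \<theta>. ennreal (w \<theta>) * f (cis \<theta>) \<partial>angle_measure) \<le> (\<integral>\<^sup>+ z. f z \<partial>\<mu>)"
proof -
  define \<nu> where "\<nu> = density angle_measure (\<lambda>\<theta>. ennreal (w \<theta>))"
  have w[measurable]: "w \<in> borel_measurable borel"
    using dec by (simp add: lebesgue_decomposition_def)
  have f'[measurable]: "f \<in> borel_measurable circle_borel"
    unfolding circle_borel_def using f by (rule measurable_restrict_space1)
  have "cis \<in> borel_measurable borel"
    by (intro borel_measurable_continuous_onI continuous_intros)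
  then have cis[measurable]: "cis \<in> borel \<rightarrow>\<^sub>M circle_borel"
    unfolding circle_borel_def by (intro measurable_restrict_space2) auto
  then have cis'[measurable]: "cis \<in> angle_measure \<rightarrow>\<^sub>M circle_borel" "cis \<in> \<nu> \<rightarrow>\<^sub>M circle_borel"
    by (simp_all add: \<nu>_def cong: measurable_cong_sets)
  have "on_circle \<nu> \<le> \<mu>"
    using dec \<mu> unfolding lebesgue_decomposition_def \<nu>_def[symmetric]
    by (subst le_measure) (auto simp: on_circle_def)
  then have "(\<integral>\<^sup>+ z. f z \<partial>on_circle \<nu>) \<le> (\<integral>\<^sup>+ z. f z \<partial>\<mu>)"
    using \<mu> by (intro nn_integral_mono_measure) (auto simp: on_circle_def)
  also have "(\<integral>\<^sup>+ z. f z \<partial>on_circle \<nu>) = (\<integral>\<^sup>+ \<theta>. f (cis \<theta>) \<partial>\<nu>)"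
    unfolding on_circle_def by (rule nn_integral_distr) measurable
  also have "\<dots> = (\<integral>\<^sup>+ \<theta>. ennreal (w \<theta>) * f (cis \<theta>) \<partial>angle_measure)"
    unfolding \<nu>_def by (rule nn_integral_density) measurable
  finally show ?thesis .
qed

text \<open>Since q ln w \<le> q w \<le> K w, the positive part has finite integral, so a value
  above - \<infinity> forces the negative part to be finite too.\<close>

lemma log_integrable_if_ext_integral_finite:
  fixes w q :: "real \<Rightarrow> real"
  assumes w[measurable]: "w \<in> borel_measurable borel" and w0: "\<And>\<theta>. \<theta> \<in> {0..<2 * pi} \<Longrightarrow> 0 \<le> w \<theta>"
    and wfin: "(\<integral>\<^sup>+ \<theta>. ennreal (w \<theta>) \<partial>angle_measure) < \<infinity>"
    and q[measurable]: "q \<in> borel_measurable borel" and q0: "\<And>\<theta>. 0 \<le> q \<theta>" and qK: "\<And>\<theta>. q \<theta> \<le> K"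
    and fin: "ext_integral angle_measure (\<lambda>\<theta>. ereal (q \<theta>) * ext_ln (w \<theta>)) > - \<infinity>"
  shows "integrable angle_measure (\<lambda>\<theta>. q \<theta> * ln (w \<theta>))"
    and "AE \<theta> in angle_measure. 0 < w \<theta> \<or> q \<theta> = 0"
proof -
  define f where "f = (\<lambda>\<theta>. ereal (q \<theta>) * ext_ln (w \<theta>))"
  have f[measurable]: "f \<in> borel_measurable borel"
    unfolding f_def ext_ln_def by measurable
  have f_pos: "f \<theta> = ereal (q \<theta> * ln (w \<theta>))" if "0 < w \<theta>" for \<theta>
    using that by (simp add: f_def ext_ln_def)
  have f_zero: "f \<theta> = (if q \<theta> = 0 then 0 else - \<infinity>)" if "w \<theta> = 0" for \<theta>
    using that q0[of \<theta>] by (simp add: f_def ext_ln_def order_less_le)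
  have e2: "e2ennreal (ereal r) = ennreal r" for r
    by (simp add: ennreal.abs_eq)
  have "AE \<theta> in angle_measure. e2ennreal (f \<theta>) \<le> ennreal K * ennreal (w \<theta>)"
    using AE_angle_measure
  proof eventually_elim
    case (elim \<theta>)
    show ?case
    proof (cases "0 < w \<theta>")
      case True
      have "q \<theta> * ln (w \<theta>) \<le> q \<theta> * w \<theta>"
        using ln_le_minus_one[OF True] q0[of \<theta>] by (intro mult_left_mono) auto
      also have "\<dots> \<le> K * w \<theta>" using qK[of \<theta>] True by (intro mult_right_mono) auto
      finally have "ennreal (q \<theta> * ln (w \<theta>)) \<le> ennreal (K * w \<theta>)" by (rule ennreal_leI)
      also have "\<dots> = ennreal K * ennreal (w \<theta>)"
        using q0[of \<theta>] qK[of \<theta>] True by (intro ennreal_mult) auto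
      finally show ?thesis using f_pos[OF True] e2 by simp
    next
      case False
      then have "w \<theta> = 0" using w0[OF elim] by simp
      then have "e2ennreal (f \<theta>) = 0" using f_zero[of \<theta>] by (auto intro: e2ennreal_neg)
      then show ?thesis by simp
    qed
  qed
  then have "(\<integral>\<^sup>+ \<theta>. e2ennreal (f \<theta>) \<partial>angle_measure)
      \<le> (\<integral>\<^sup>+ \<theta>. ennreal K * ennreal (w \<theta>) \<partial>angle_measure)"
    by (rule nn_integral_mono_AE)
  also have "\<dots> = ennreal K * (\<integral>\<^sup>+ \<theta>. ennreal (w \<theta>) \<partial>angle_measure)"
    by (rule nn_integral_cmult) measurable
  also have "\<dots> < \<infinity>" using wfin by (simp add: ennreal_mult_less_top)
  finally have pos_fin: "(\<integral>\<^sup>+ \<theta>. e2ennreal (f \<theta>) \<partial>angle_measure) < \<infinity>" .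
  have neg_fin: "(\<integral>\<^sup>+ \<theta>. e2ennreal (- f \<theta>) \<partial>angle_measure) < \<infinity>"
  proof (rule ccontr)
    assume "\<not> ?thesis"
    then have "(\<integral>\<^sup>+ \<theta>. e2ennreal (- f \<theta>) \<partial>angle_measure) = \<infinity>"
      by (metis infinity_ennreal_def less_top)
    moreover obtain r where "(\<integral>\<^sup>+ \<theta>. e2ennreal (f \<theta>) \<partial>angle_measure) = ennreal r" "0 \<le> r"
      using pos_fin by (cases "\<integral>\<^sup>+ \<theta>. e2ennreal (f \<theta>) \<partial>angle_measure") auto
    \<comment> \<open>Finiteness of the positive part matters here, because \<infinity> -
      \<infinity> would be \<infinity>.\<close>
    ultimately have "ext_integral angle_measure f = - \<infinity>"
      by (simp add: ext_integral_def)
    then show False using fin by (simp add: f_def)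
  qed
  have "AE \<theta> in angle_measure. e2ennreal (- f \<theta>) \<noteq> \<infinity>"
    using neg_fin by (intro nn_integral_noteq_infinite) auto
  then show "AE \<theta> in angle_measure. 0 < w \<theta> \<or> q \<theta> = 0"
    using AE_angle_measure
  proof eventually_elim
    case (elim \<theta>)
    show ?case
    proof (rule ccontr)
      assume "\<not> ?thesis"
      then have "w \<theta> = 0" "q \<theta> \<noteq> 0" using w0[OF elim(2)] by auto
      then have "- f \<theta> = \<infinity>" using f_zero by simp
      then show False using elim(1) by simp
    qed
  qed
  have "AE \<theta> in angle_measure. ennreal (norm (q \<theta> * ln (w \<theta>))) \<le> e2ennreal (f \<theta>) + e2ennreal (- f \<theta>)"
    using AE_angle_measure
  proof eventually_elim
    case (elim \<theta>)
    show ?case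
    proof (cases "0 < w \<theta>")
      case True
      then show ?thesis
        using f_pos[OF True] e2[of "q \<theta> * ln (w \<theta>)"] e2[of "- (q \<theta> * ln (w \<theta>))"]
        by (cases "0 \<le> q \<theta> * ln (w \<theta>)") (auto simp: ennreal_neg)
    next
      case False
      then have "w \<theta> = 0" using w0[OF elim] by simp
      \<comment> \<open>As \<open>ln 0 = 0\<close>, the real integrand vanishes here; that w = 0
        happens almost only where q = 0 is recorded by the second conclusion.\<close>
      then show ?thesis by simp
    qed
  qed
  then have "(\<integral>\<^sup>+ \<theta>. ennreal (norm (q \<theta> * ln (w \<theta>))) \<partial>angle_measure)
      \<le> (\<integral>\<^sup>+ \<theta>. e2ennreal (f \<theta>) + e2ennreal (- f \<theta>) \<partial>angle_measure)"
    by (rule nn_integral_mono_AE)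
  also have "\<dots> = (\<integral>\<^sup>+ \<theta>. e2ennreal (f \<theta>) \<partial>angle_measure) + (\<integral>\<^sup>+ \<theta>. e2ennreal (- f \<theta>) \<partial>angle_measure)"
    by (rule nn_integral_add) measurable
  also have "\<dots> < \<infinity>" using pos_fin neg_fin by simp
  finally show "integrable angle_measure (\<lambda>\<theta>. q \<theta> * ln (w \<theta>))"
    by (intro integrableI_bounded) measurable
qed

text \<open>Pointwise ln x \<le> x at x = w P / N, weighted by q \<le> K, in place of Jensen's
  inequality. The bound does not depend on \<open>P\<close> and \<open>N\<close>, hence is uniform
  along the recurrence.\<close>

lemma weighted_log_integral_le:
  fixes w q P :: "real \<Rightarrow> real"
  assumes w[measurable]: "w \<in> borel_measurable borel" and w0: "\<And>\<theta>. \<theta> \<in> {0..<2 * pi} \<Longrightarrow> 0 \<le> w \<theta>"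
    and q: "continuous_on UNIV q" "\<And>\<theta>. 0 \<le> q \<theta>" "\<And>\<theta>. q \<theta> \<le> K"
    and u: "integrable angle_measure (\<lambda>\<theta>. q \<theta> * ln (w \<theta>))"
    and wpos: "AE \<theta> in angle_measure. 0 < w \<theta> \<or> q \<theta> = 0"
    and P: "continuous_on UNIV P" "\<And>\<theta>. 0 < P \<theta>" and N: "0 < N"
    and PN: "(\<integral>\<^sup>+ \<theta>. ennreal (w \<theta>) * ennreal (P \<theta>) \<partial>angle_measure) \<le> ennreal N"
  shows "(LINT \<theta>|angle_measure. q \<theta> * ln (P \<theta>)) - ln N * (LINT \<theta>|angle_measure. q \<theta>)
      \<le> K - (LINT \<theta>|angle_measure. q \<theta> * ln (w \<theta>))"
proof -
  have [measurable]: "P \<in> borel_measurable borel" "q \<in> borel_measurable borel"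
    using P q by (simp_all add: borel_measurable_continuous_onI)
  have eqwP: "(\<integral>\<^sup>+ \<theta>. ennreal (w \<theta> * P \<theta>) \<partial>angle_measure) =
      (\<integral>\<^sup>+ \<theta>. ennreal (w \<theta>) * ennreal (P \<theta>) \<partial>angle_measure)"
  proof (rule nn_integral_cong_AE)
    show "AE \<theta> in angle_measure. ennreal (w \<theta> * P \<theta>) = ennreal (w \<theta>) * ennreal (P \<theta>)"
      using AE_angle_measure
      by eventually_elim (rule ennreal_mult[OF w0 less_imp_le[OF P(2)]])
  qed
  have nonneg: "AE \<theta> in angle_measure. 0 \<le> w \<theta> * P \<theta>"
    using AE_angle_measure
    by eventually_elim (rule mult_nonneg_nonneg[OF w0 less_imp_le[OF P(2)]])
  have wP: "integrable angle_measure (\<lambda>\<theta>. w \<theta> * P \<theta>)"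
    using eqwP PN nonneg
    by (intro integrableI_nonneg) (auto simp: less_top[symmetric] top_unique)
  have "ennreal (LINT \<theta>|angle_measure. w \<theta> * P \<theta>) \<le> ennreal N"
    using nn_integral_eq_integral[OF wP nonneg] eqwP PN by simp
  then have le_N: "(LINT \<theta>|angle_measure. w \<theta> * P \<theta>) \<le> N"
    using N by (simp add: ennreal_le_iff)
  have K: "0 \<le> K" using q(2,3) order_trans by blast
  have "P \<theta> \<noteq> 0" for \<theta> using P(2)[of \<theta>] by simp
  then have int: "integrable angle_measure (\<lambda>\<theta>. q \<theta> * ln (P \<theta>))" "integrable angle_measure q"
    using P(1) q(1) by (auto intro!: angle_integrable continuous_intros)
  have "(LINT \<theta>|angle_measure. q \<theta> * ln (w \<theta>) + q \<theta> * ln (P \<theta>) - ln N * q \<theta>)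
      \<le> (LINT \<theta>|angle_measure. K / N * (w \<theta> * P \<theta>))"
  proof (rule integral_mono_AE)
    show "AE \<theta> in angle_measure. q \<theta> * ln (w \<theta>) + q \<theta> * ln (P \<theta>) - ln N * q \<theta> \<le> K / N * (w \<theta> * P \<theta>)"
      using wpos nonneg
    proof eventually_elim
      case (elim \<theta>)
      show ?case
      proof (cases "q \<theta> = 0")
        case True
        then show ?thesis using K N elim(2) by simp
      next
        case False
        then have w: "0 < w \<theta>" using elim(1) by simp
        have pos: "0 < w \<theta> * P \<theta> / N" using w P(2)[of \<theta>] N by simp
        have "q \<theta> * ln (w \<theta>) + q \<theta> * ln (P \<theta>) - ln N * q \<theta> = q \<theta> * ln (w \<theta> * P \<theta> / N)"
          using w P(2)[of \<theta>] N by (simp add: ln_div ln_mult algebra_simps)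
        also have "\<dots> \<le> q \<theta> * (w \<theta> * P \<theta> / N)"
          using ln_le_minus_one[OF pos] q(2) by (intro mult_left_mono) auto
        also have "\<dots> \<le> K * (w \<theta> * P \<theta> / N)"
          using q(3) pos by (intro mult_right_mono) auto
        finally show ?thesis by simp
      qed
    qed
  qed (use u int wP in auto)
  also have "\<dots> \<le> K"
    using mult_left_mono[OF le_N, of "K / N"] K N by simp
  finally show ?thesis using u int by simp
qed

section \<open>Summability\<close>

text \<open>The local bound makes each \<open>d j\<close> at most an increment of E - G. The partial
  sums telescope, with \<open>E\<close> bounded above by hypothesis and \<open>G\<close> bounded by
  compactness.\<close>

lemma summable_if_sum_rule_bounded:
  assumes local_bound: "sum_rule_local_bound c0 c1 c2 c3 D" and D: "\<And>x y z t. 0 \<le> D x y z t"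
    and \<alpha>: "\<And>n. cmod (\<alpha> n) < 1"
    and N: "\<And>n. 0 < N n" "\<And>n. N (Suc n) = (1 - (cmod (\<alpha> n))\<^sup>2) * N n"
    and bound: "\<And>n. c1 * Re (log_coeff (szego_rev \<alpha> n) 1) + c2 * Re (log_coeff (szego_rev \<alpha> n) 2)
      + c3 * Re (log_coeff (szego_rev \<alpha> n) 3) - c0 * ln (N n) \<le> C"
  shows "summable (\<lambda>j. D (\<alpha> j) (\<alpha> (Suc j)) (\<alpha> (Suc (Suc j))) (\<alpha> (Suc (Suc (Suc j)))))"
proof -
  obtain F where F: "continuous_on UNIV (\<lambda>(x, y, z). F x y z)"
    and le: "\<And>x y z t. cmod t < 1 \<Longrightarrow> D x y z t + F y z t - F x y z \<le>
          c1 * Re (log_coeff_step1 z t) + c2 * Re (log_coeff_step2 y z t)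
          + c3 * Re (log_coeff_step3 x y z t) - c0 * ln (1 - (cmod t)\<^sup>2)"
    using local_bound unfolding sum_rule_local_bound_def by blast
  define K where "K = cball (0::complex) 1 \<times> cball (0::complex) 1 \<times> cball (0::complex) 1"
  have "compact K" unfolding K_def by (intro compact_Times compact_cball)
  then have "bounded ((\<lambda>(x, y, z). F x y z) ` K)"
    using F by (intro compact_imp_bounded compact_continuous_image) (auto intro: continuous_on_subset)
  then obtain B where "\<forall>v \<in> (\<lambda>(x, y, z). F x y z) ` K. norm v \<le> B"
    unfolding bounded_iff by blast
  then have B: "\<bar>F x y z\<bar> \<le> B" if "(x, y, z) \<in> K" for x y z
    using that by force
  define G where "G = (\<lambda>j. F (\<alpha> j) (\<alpha> (Suc j)) (\<alpha> (Suc (Suc j))))"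
  have G: "\<bar>G j\<bar> \<le> B" for j
    using B[of "\<alpha> j" "\<alpha> (Suc j)" "\<alpha> (Suc (Suc j))"] \<alpha> by (simp add: G_def K_def less_imp_le)
  define E where "E = (\<lambda>n. c1 * Re (log_coeff (szego_rev \<alpha> n) 1)
      + c2 * Re (log_coeff (szego_rev \<alpha> n) 2)
      + c3 * Re (log_coeff (szego_rev \<alpha> n) 3) - c0 * ln (N n))"
  define d where
    "d = (\<lambda>j. D (\<alpha> j) (\<alpha> (Suc j)) (\<alpha> (Suc (Suc j))) (\<alpha> (Suc (Suc (Suc j)))))"
  \<comment> \<open>The window of four coefficients begins at j, so \<open>E\<close> is advanced
    from j + 3 to j + 4.\<close>
  have step: "d j \<le> (E (Suc (Suc (Suc (Suc j)))) - G (Suc j)) - (E (Suc (Suc (Suc j))) - G j)" for j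
  proof -
    let ?n = "Suc (Suc (Suc j))"
    have "(cmod (\<alpha> ?n))\<^sup>2 < 1" using \<alpha> by (simp add: abs_square_less_1)
    then have "ln (N (Suc ?n)) = ln (1 - (cmod (\<alpha> ?n))\<^sup>2) + ln (N ?n)"
      using N(1)[of ?n] unfolding N(2)[of ?n] by (simp add: ln_mult)
    moreover have "Re (log_coeff (szego_rev \<alpha> (Suc ?n)) 1) =
          Re (log_coeff (szego_rev \<alpha> ?n) 1) + Re (log_coeff_step1 (\<alpha> (Suc (Suc j))) (\<alpha> ?n))"
      and "Re (log_coeff (szego_rev \<alpha> (Suc ?n)) 2) =
          Re (log_coeff (szego_rev \<alpha> ?n) 2)
          + Re (log_coeff_step2 (\<alpha> (Suc j)) (\<alpha> (Suc (Suc j))) (\<alpha> ?n))"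
      and "Re (log_coeff (szego_rev \<alpha> (Suc ?n)) 3) =
          Re (log_coeff (szego_rev \<alpha> ?n) 3)
          + Re (log_coeff_step3 (\<alpha> j) (\<alpha> (Suc j)) (\<alpha> (Suc (Suc j))) (\<alpha> ?n))"
      using log_coeff_szego_rev_Suc[of \<alpha> j]
      by (simp_all only: diff_eq_eq plus_complex.sel add.commute)
    ultimately show ?thesis
      using le[OF \<alpha>[of ?n], of "\<alpha> j" "\<alpha> (Suc j)" "\<alpha> (Suc (Suc j))"]
      unfolding E_def d_def G_def by (simp only: distrib_left)
  qed
  have "(\<Sum>j<n. d j) \<le> C + B - (E 3 - G 0)" for n
  proof -
    have "(\<Sum>j<n. d j) \<le> (E (n + 3) - G n) - (E 3 - G 0)"
    proof (induction n)
      case 0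
      then show ?case by simp
    next
      case (Suc n)
      then show ?case using step[of n] by (simp add: eval_nat_numeral)
    qed
    moreover have "E (n + 3) \<le> C" unfolding E_def by (rule bound)
    ultimately show ?thesis using G[of n] by linarith
  qed
  then have "summable d"
    using D by (intro summableI_nonneg_bounded) (auto simp: d_def)
  then show ?thesis unfolding d_def .
qed

text \<open>Expanding q into cosines turns the entropy bound into the bound required by
  \<open>summable_if_sum_rule_bounded\<close>: each mode of ln P yields a Taylor coefficient, and
  the integral of q is c0.\<close>

lemma summable_if_trigonometric_weight:
  assumes \<mu>: "nontrivial_prob_on_circle \<mu>" and dec: "lebesgue_decomposition \<mu> w \<mu>s"
    and \<alpha>: "verblunsky_coeffs \<mu> \<alpha>"
    and fin: "ext_integral angle_measure (\<lambda>\<theta>. ereal (q \<theta>) * ext_ln (w \<theta>)) > - \<infinity>"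
    and q: "\<And>\<theta>. q \<theta> = c0 + c1 * cos \<theta> + c2 * cos (2 * \<theta>) + c3 * cos (3 * \<theta>)"
    and q0: "\<And>\<theta>. 0 \<le> q \<theta>"
    and local_bound: "sum_rule_local_bound c0 c1 c2 c3 D" and D: "\<And>x y z t. 0 \<le> D x y z t"
  shows "summable (\<lambda>j. D (\<alpha> j) (\<alpha> (Suc j)) (\<alpha> (Suc (Suc j))) (\<alpha> (Suc (Suc (Suc j)))))"
proof -
  have prob: "prob_space \<mu>" "sets \<mu> = sets circle_borel"
    using \<mu> by (auto simp: nontrivial_prob_on_circle_def)
  interpret prob_space \<mu> by fact
  have orth: "monic_orthogonal_polys \<mu> (szego_poly \<alpha>)"
    using \<alpha> by (rule verblunsky_imp_szego_polys)
  define N where "N = (\<lambda>n. LINT z|\<mu>. (cmod (poly (szego_poly \<alpha> n) z))\<^sup>2)"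
  have N_pos: "0 < N n" for n
    unfolding N_def by (rule szego_poly_norm_pos[OF \<mu> orth])
  have N_Suc: "N (Suc n) = (1 - (cmod (\<alpha> n))\<^sup>2) * N n" for n
    unfolding N_def by (rule szego_poly_norm_Suc[OF prob orth])
  \<comment> \<open>Consecutive norms are positive, so their ratio 1 - |alpha_n|^2 is
    positive.\<close>
  have \<alpha>1: "cmod (\<alpha> n) < 1" for n
  proof -
    have "0 < 1 - (cmod (\<alpha> n))\<^sup>2"
      using N_pos[of n] N_pos[of "Suc n"] unfolding N_Suc by (simp add: zero_less_mult_iff)
    then show ?thesis by (simp add: abs_square_less_1)
  qed
  have w: "w \<in> borel_measurable borel" "\<And>\<theta>. \<theta> \<in> {0..<2 * pi} \<Longrightarrow> 0 \<le> w \<theta>"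
    using dec by (auto simp: lebesgue_decomposition_def)
  have q_cont: "continuous_on UNIV q"
    unfolding q[abs_def] by (intro continuous_intros)
  define K where "K = \<bar>c0\<bar> + \<bar>c1\<bar> + \<bar>c2\<bar> + \<bar>c3\<bar>"
  have qK: "q \<theta> \<le> K" for \<theta>
  proof -
    have "c * cos x \<le> \<bar>c\<bar>" for c x :: real
    proof -
      have "c * cos x \<le> \<bar>c\<bar> * \<bar>cos x\<bar>" by (metis abs_ge_self abs_mult)
      also have "\<dots> \<le> \<bar>c\<bar> * 1" by (intro mult_left_mono) auto
      finally show ?thesis by simp
    qed
    from this[of c1 \<theta>] this[of c2 "2 * \<theta>"] this[of c3 "3 * \<theta>"] show ?thesis
      unfolding q K_def by linarith
  qed
  have w_fin: "(\<integral>\<^sup>+ \<theta>. ennreal (w \<theta>) \<partial>angle_measure) < \<infinity>"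
  proof -
    have "(\<integral>\<^sup>+ \<theta>. ennreal (w \<theta>) * 1 \<partial>angle_measure) \<le> (\<integral>\<^sup>+ z. 1 \<partial>\<mu>)"
      by (rule abs_continuous_part_le[OF dec prob(2)]) simp
    then show ?thesis using emeasure_space_1 by (simp add: le_less_trans[OF _ ennreal_one_less_top])
  qed
  note log_int = log_integrable_if_ext_integral_finite[OF w w_fin
      borel_measurable_continuous_onI[OF q_cont] q0 qK fin]
  define C where "C = K - (LINT \<theta>|angle_measure. q \<theta> * ln (w \<theta>))"
  have "c1 * Re (log_coeff (szego_rev \<alpha> n) 1) + c2 * Re (log_coeff (szego_rev \<alpha> n) 2)
      + c3 * Re (log_coeff (szego_rev \<alpha> n) 3) - c0 * ln (N n) \<le> C" for n
  proof -
    \<comment> \<open>The reversed polynomial is used because it is zero-free in the closed disk,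
      while its norm is the same.\<close>
    define p where "p = szego_rev \<alpha> n"
    define P where "P = (\<lambda>\<theta>. (cmod (poly p (cis \<theta>)))\<^sup>2)"
    have p_nz: "poly p z \<noteq> 0" if "cmod z \<le> 1" for z
      unfolding p_def using szego_rev_dominates[of \<alpha>, OF \<alpha>1 that] by blast
    have P: "continuous_on UNIV P" "\<And>\<theta>. 0 < P \<theta>"
      unfolding P_def using p_nz by (auto intro!: continuous_intros)
    have "(\<integral>\<^sup>+ \<theta>. ennreal (w \<theta>) * ennreal (P \<theta>) \<partial>angle_measure)
        \<le> (\<integral>\<^sup>+ z. ennreal ((cmod (poly p z))\<^sup>2) \<partial>\<mu>)"
      unfolding P_def
      by (rule abs_continuous_part_le[OF dec prob(2), of "\<lambda>z. ennreal ((cmod (poly p z))\<^sup>2)"])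
        (intro borel_measurable_continuous_onI measurable_compose[OF _ measurable_ennreal] continuous_intros)
    also have "\<dots> = ennreal (LINT z|\<mu>. (cmod (poly p z))\<^sup>2)"
      by (intro nn_integral_eq_integral circle_measure_integrable[OF prob] continuous_intros) auto
    also have "(LINT z|\<mu>. (cmod (poly p z))\<^sup>2) = N n"
      unfolding N_def p_def
    proof (rule Bochner_Integration.integral_cong[OF refl])
      fix z assume "z \<in> space \<mu>"
      then have "cmod z = 1"
        using sets_eq_imp_space_eq[OF prob(2)] by (simp add: circle_borel_def space_restrict_space)
      then show "(cmod (poly (szego_rev \<alpha> n) z))\<^sup>2 = (cmod (poly (szego_poly \<alpha> n) z))\<^sup>2"
        by (simp add: cmod_szego_rev_on_circle)
    qed
    finally have PN: "(\<integral>\<^sup>+ \<theta>. ennreal (w \<theta>) * ennreal (P \<theta>) \<partial>angle_measure) \<le> ennreal (N n)" .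
    have entropy: "(LINT \<theta>|angle_measure. q \<theta> * ln (P \<theta>)) - ln (N n) * (LINT \<theta>|angle_measure. q \<theta>) \<le> C"
      unfolding C_def
      by (rule weighted_log_integral_le[OF w q_cont q0 qK log_int P N_pos PN])
    have cos_cont: "continuous_on UNIV (\<lambda>\<theta>. cos (real k * \<theta>) * ln (P \<theta>))" for k
    proof -
      have "P \<theta> \<noteq> 0" for \<theta> using P(2)[of \<theta>] by simp
      then show ?thesis using P(1) by (intro continuous_intros) auto
    qed
    have mode: "integrable angle_measure (\<lambda>\<theta>. cos (real k * \<theta>) * ln (P \<theta>))"
      "(LINT \<theta>|angle_measure. cos (real k * \<theta>) * ln (P \<theta>)) = Re (log_coeff p k)"
      if "k \<in> {0, 1, 2, 3}" for k
      using has_integral_imp_angle_integral[OF cos_cont] integral_cos_mode_log_poly[OF p_nz _ that]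
      unfolding P_def p_def by simp_all
    have "(LINT \<theta>|angle_measure. q \<theta> * ln (P \<theta>)) = (LINT \<theta>|angle_measure.
        c0 * (cos (real 0 * \<theta>) * ln (P \<theta>)) + c1 * (cos (real 1 * \<theta>) * ln (P \<theta>))
        + c2 * (cos (real 2 * \<theta>) * ln (P \<theta>)) + c3 * (cos (real 3 * \<theta>) * ln (P \<theta>)))"
      unfolding q by (simp add: algebra_simps)
    also have "\<dots> = c0 * Re (log_coeff p 0) + c1 * Re (log_coeff p 1)
        + c2 * Re (log_coeff p 2) + c3 * Re (log_coeff p 3)"
      using mode[of 0] mode[of 1] mode[of 2] mode[of 3] by simp
    also have "log_coeff p 0 = 0" by (simp add: log_coeff_def)
    finally have 1: "(LINT \<theta>|angle_measure. q \<theta> * ln (P \<theta>)) = c1 * Re (log_coeff p 1)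
        + c2 * Re (log_coeff p 2) + c3 * Re (log_coeff p 3)" by simp
    define e where "e = (\<lambda>k \<theta>. cos (real k * \<theta>))"
    have e: "integrable angle_measure (e k)" "(LINT \<theta>|angle_measure. e k \<theta>) = (if k = 0 then 1 else 0)"
      for k
      unfolding e_def by (intro angle_integrable continuous_intros) (rule angle_integral_cos)
    have "(LINT \<theta>|angle_measure. q \<theta>) = (LINT \<theta>|angle_measure.
        c0 * e 0 \<theta> + c1 * e 1 \<theta> + c2 * e 2 \<theta> + c3 * e 3 \<theta>)"
      unfolding q e_def by simp
    also have "\<dots> = c0"
      using e[of 0] e[of 1] e[of 2] e[of 3] by simp
    finally show ?thesis using entropy unfolding 1 p_def by (simp add: mult.commute)
  qed
  from summable_if_sum_rule_bounded[OF local_bound D \<alpha>1 N_pos N_Suc this] show ?thesis .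
qed

text \<open>The offset 3 is the position of the last entry in a window of four coefficients.\<close>

lemma summable_shifted_components:
  fixes f g :: "nat \<Rightarrow> real"
  assumes "summable (\<lambda>j. (f j + g (j + 3)) / c)" "0 < c" "\<And>j. 0 \<le> f j" "\<And>j. 0 \<le> g j"
  shows "summable f" "summable g"
proof -
  have s: "summable (\<lambda>j. f j + g (j + 3))"
    using assms(1,2) summable_mult[of "\<lambda>j. (f j + g (j + 3)) / c" c] by simp
  show "summable f"
    by (rule summable_comparison_test'[OF s, of 0]) (use assms in auto)
  have "summable (\<lambda>j. g (j + 3))"
    by (rule summable_comparison_test'[OF s, of 0]) (use assms in auto)
  then show "summable g" by (simp only: summable_iff_shift)
qed

theorem theorem1p1:
  fixes m :: nat and \<mu> \<mu>s :: "complex measure" and w :: "real \<Rightarrow> real"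
    and \<alpha> :: "nat \<Rightarrow> complex"
  assumes "m \<in> {1, 2, 3}"
    and "nontrivial_prob_on_circle \<mu>"
    and "lebesgue_decomposition \<mu> w \<mu>s"
    and "verblunsky_coeffs \<mu> \<alpha>"
    and "ext_integral angle_measure (\<lambda>\<theta>. ereal ((1 - cos \<theta>) ^ m) * ext_ln (w \<theta>)) > - \<infinity>"
  shows "(shift_minus_one ^^ m) \<alpha> \<in> ell 2 \<and> \<alpha> \<in> ell (2 * m + 2)"
proof -
  note rule = summable_if_trigonometric_weight[OF assms(2-5)]
  have q0: "0 \<le> (1 - cos \<theta>) ^ m" for \<theta> :: real by simp
  \<comment> \<open>The cosine coefficients are those of the three local bounds.\<close>
  have trig1: "(1 - cos \<theta>) ^ 1 = 1 + - 1 * cos \<theta> + 0 * cos (2 * \<theta>) + 0 * cos (3 * \<theta>)"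
    and trig2: "(1 - cos \<theta>) ^ 2 = 3 / 2 + - 2 * cos \<theta> + 1 / 2 * cos (2 * \<theta>) + 0 * cos (3 * \<theta>)"
    and trig3: "(1 - cos \<theta>) ^ 3 =
      5 / 2 + - 15 / 4 * cos \<theta> + 3 / 2 * cos (2 * \<theta>) + - 1 / 4 * cos (3 * \<theta>)" for \<theta> :: real
    unfolding cos_double_cos cos_treble_cos
    by (simp_all add: power2_eq_square power3_eq_cube algebra_simps)
  consider "m = 1" | "m = 2" | "m = 3" using assms(1) by auto
  then show ?thesis
  proof cases
    case 1
    have "summable (\<lambda>j. ((cmod (\<alpha> (Suc (Suc (Suc j))) - \<alpha> (Suc (Suc j))))\<^sup>2
        + (cmod (\<alpha> (Suc (Suc (Suc j))))) ^ 4) / 2)"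
      by (rule rule[OF _ q0 sum_rule_local_bound1]) (unfold 1, rule trig1, simp)
    \<comment> \<open>The m-th difference occupies the last m + 1 places of the window, so it starts
      at j + 3 - m; dropping finitely many initial terms does not affect summability.\<close>
    then have "summable (\<lambda>j. ((cmod (shift_minus_one \<alpha> (j + 2)))\<^sup>2 + (cmod (\<alpha> (j + 3))) ^ 4) / 2)"
      by (simp add: shift_minus_one_def shift_def eval_nat_numeral)
    from summable_shifted_components[OF this] have
      "summable (\<lambda>j. (cmod (shift_minus_one \<alpha> (j + 2)))\<^sup>2)" "summable (\<lambda>j. (cmod (\<alpha> j)) ^ 4)"
      by simp_all
    then show ?thesis using 1 summable_iff_shift[of "\<lambda>j. (cmod (shift_minus_one \<alpha> j))\<^sup>2" 2]
      by (simp add: ell_def)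
  next
    case 2
    have "summable (\<lambda>j. ((cmod (\<alpha> (Suc (Suc (Suc j))) - 2 * \<alpha> (Suc (Suc j)) + \<alpha> (Suc j)))\<^sup>2
        + (cmod (\<alpha> (Suc (Suc (Suc j))))) ^ 6) / 4)"
      by (rule rule[OF _ q0 sum_rule_local_bound2]) (unfold 2, rule trig2, simp)
    then have "summable (\<lambda>j. ((cmod ((shift_minus_one ^^ 2) \<alpha> (j + 1)))\<^sup>2 + (cmod (\<alpha> (j + 3))) ^ 6) / 4)"
      by (simp add: shift_minus_one_def shift_def numeral_2_eq_2 numeral_3_eq_3 algebra_simps)
    from summable_shifted_components[OF this] have
      "summable (\<lambda>j. (cmod ((shift_minus_one ^^ 2) \<alpha> (j + 1)))\<^sup>2)" "summable (\<lambda>j. (cmod (\<alpha> j)) ^ 6)"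
      by simp_all
    then show ?thesis using 2 summable_iff_shift[of "\<lambda>j. (cmod ((shift_minus_one ^^ 2) \<alpha> j))\<^sup>2" 1]
      by (simp add: ell_def)
  next
    case 3
    have "summable (\<lambda>j. ((cmod (\<alpha> (Suc (Suc (Suc j))) - 3 * \<alpha> (Suc (Suc j)) + 3 * \<alpha> (Suc j) - \<alpha> j))\<^sup>2
        + (cmod (\<alpha> (Suc (Suc (Suc j))))) ^ 8) / 48)"
      by (rule rule[OF _ q0 sum_rule_local_bound3]) (unfold 3, rule trig3, simp)
    then have "summable (\<lambda>j. ((cmod ((shift_minus_one ^^ 3) \<alpha> j))\<^sup>2 + (cmod (\<alpha> (j + 3))) ^ 8) / 48)"
      by (simp add: shift_minus_one_def shift_def numeral_3_eq_3 algebra_simps)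
    from summable_shifted_components[OF this] show ?thesis using 3 by (simp add: ell_def)
  qed
qed

end
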